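(* Let $M$ be a locally quaternionic projective flat manifold of quaternionic dimension $n$ and let $u\in\Gamma(M,\mathbb R[-1])$ be a smooth section. Then $\dfrac{M(u)}{u^{2n+1}}$ is quaternionic projectively invariant: if $u_\alpha,u_\beta$ are the local representatives of $u$ in two charts $\phi_\alpha,\phi_\beta$ with transition map $\phi_\beta\circ\phi_\alpha^{-1}=g_{\alpha\beta}^{-1}.$, then $$\frac{M(u_\alpha)}{u_\alpha^{2n+1}}(\mathbf q)=\frac{M(u_\beta)}{u_\beta^{2n+1}}\big(g_{\alpha\beta}^{-1}.\mathbf q\big)$$ for $\mathbf q\in\phi_\alpha(U_\alpha\cap U_\beta)$ with $u_\alpha(\mathbf q)\neq0$; that is, $M(u)/u^{2n+1}$ is a well-defined scalar function where $u\ne0$.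
   Context: $\mathrm{SL}(n+1,\mathbb H)$ is the group of quaternionic $(n+1)\times(n+1)$ matrices whose image under the standard embedding into complex $(2n+2)\times(2n+2)$ matrices has determinant $1$. For $g\in\mathrm{SL}(n+1,\mathbb H)$ with $g^{-1}=\begin{pmatrix}\mathbf a&\mathbf b\\ \mathbf c&\mathbf d\end{pmatrix}$ (blocks $1\times1,1\times n,n\times1,n\times n$) put $g^{-1}.\mathbf q=(\mathbf c+\mathbf d\mathbf q)(\mathbf a+\mathbf b\mathbf q)^{-1}$ for column vectors $\mathbf q\in\mathbb H^n$ with $\mathbf a+\mathbf b\mathbf q\ne0$. A manifold $M$ is locally quaternionic projective flat if it has coordinate charts $\{(U_\alpha,\phi_\alpha)\}$, $\phi_\alpha:U_\alpha\to\mathbb H^n$, whose transition maps $\phi_\beta\circ\phi_\alpha^{-1}:\phi_\alpha(U_\alpha\cap U_\beta)\to\phi_\beta(U_\alpha\cap U_\beta)$ are of the form $\mathbf q\mapsto g_{\alpha\beta}^{-1}.\mathbf q$ with $g_{\alpha\beta}\in\mathrm{SL}(n+1,\mathbb H)$. A smooth section $u$ of the real line bundle $\mathbb R[-1]$ is a family of smooth real functions $u_\alpha$ on $\phi_\alpha(U_\alpha)$ such that $u_\alpha(\mathbf q)=|\mathbf a+\mathbf b\mathbf q|^{-2}u_\beta(g_{\alpha\beta}^{-1}.\mathbf q)$ on overlaps, where $\mathbf a,\mathbf b$ are the blocks of $g_{\alpha\beta}^{-1}$. With $\mathbf q=(\mathbf q_1,\dots,\mathbf q_n)^t$, $\mathbf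 q_{l+1}=x_{4l}+\mathbf i x_{4l+1}+\mathbf j x_{4l+2}+\mathbf k x_{4l+3}$, put for $l=0,\dots,n-1$ $$\nabla^{0'}_{2l}=\tfrac12(\partial_{x_{4l}}-\mathbf i\partial_{x_{4l+1}}),\ \nabla^{0'}_{2l+1}=\tfrac12(\partial_{x_{4l+2}}+\mathbf i\partial_{x_{4l+3}}),\ \nabla^{1'}_{2l}=\tfrac12(-\partial_{x_{4l+2}}+\mathbf i\partial_{x_{4l+3}}),\ \nabla^{1'}_{2l+1}=\tfrac12(\partial_{x_{4l}}+\mathbf i\partial_{x_{4l+1}}).$$ Let $\omega^0,\dots,\omega^{2n-1}$ be anticommuting variables (a basis of $\mathbb C^{2n*}$), $d^{A'}(f_{\mathbf A}\omega^{\mathbf A})=\sum_A\nabla^{A'}_Af_{\mathbf A}\,\omega^A\wedge\omega^{\mathbf A}$, and $\triangle v=d^{0'}d^{1'}v$ for a smooth function $v$ on an open subset of $\mathbb H^n$. The function $M(v)$ is defined by $(\triangle v)^n=\triangle v\wedge\cdots\wedge\triangle v=M(v)\,\Omega_{2n}$, where $\Omega_{2n}=\omega^0\wedge\omega^1\wedge\cdots\wedge\omega^{2n-1}$. *)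

theory Defs
  imports "HOL-Analysis.Analysis"
begin

section \<open>Quaternions\<close>

datatype quat = Quat (Q0: real) (Q1: real) (Q2: real) (Q3: real)

lemma quat_eq_iff: "x = y \<longleftrightarrow> Q0 x = Q0 y \<and> Q1 x = Q1 y \<and> Q2 x = Q2 y \<and> Q3 x = Q3 y"
  by (cases x; cases y) simp

instantiation quat :: ab_group_add
begin

definition "0 = Quat 0 0 0 0"
definition "x + y = Quat (Q0 x + Q0 y) (Q1 x + Q1 y) (Q2 x + Q2 y) (Q3 x + Q3 y)"
definition "- x = Quat (- Q0 x) (- Q1 x) (- Q2 x) (- Q3 x)"
definition "x - y = Quat (Q0 x - Q0 y) (Q1 x - Q1 y) (Q2 x - Q2 y) (Q3 x - Q3 y)"

instance
  by standard
    (simp_all add: quat_eq_iff zero_quat_def plus_quat_def uminus_quat_def minus_quat_def)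

end

lemma quat_add_simps [simp]:
  "Q0 0 = 0" "Q1 0 = 0" "Q2 0 = 0" "Q3 0 = 0"
  "Q0 (x + y) = Q0 x + Q0 y" "Q1 (x + y) = Q1 x + Q1 y"
  "Q2 (x + y) = Q2 x + Q2 y" "Q3 (x + y) = Q3 x + Q3 y"
  "Q0 (- x) = - Q0 x" "Q1 (- x) = - Q1 x" "Q2 (- x) = - Q2 x" "Q3 (- x) = - Q3 x"
  "Q0 (x - y) = Q0 x - Q0 y" "Q1 (x - y) = Q1 x - Q1 y"
  "Q2 (x - y) = Q2 x - Q2 y" "Q3 (x - y) = Q3 x - Q3 y"
  by (simp_all add: zero_quat_def plus_quat_def uminus_quat_def minus_quat_def)

instantiation quat :: real_vector
begin

definition "scaleR r x = Quat (r * Q0 x) (r * Q1 x) (r * Q2 x) (r * Q3 x)"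

instance
  by standard (simp_all add: quat_eq_iff scaleR_quat_def algebra_simps)

end

lemma quat_scaleR_simps [simp]:
  "Q0 (r *\<^sub>R x) = r * Q0 x" "Q1 (r *\<^sub>R x) = r * Q1 x"
  "Q2 (r *\<^sub>R x) = r * Q2 x" "Q3 (r *\<^sub>R x) = r * Q3 x"
  by (simp_all add: scaleR_quat_def)

instantiation quat :: real_inner
begin

definition "inner x y = Q0 x * Q0 y + Q1 x * Q1 y + Q2 x * Q2 y + Q3 x * Q3 y"
definition "norm (x :: quat) = sqrt (inner x x)"
definition "sgn (x :: quat) = x /\<^sub>R norm x"
definition "dist (x :: quat) y = norm (x - y)"
definition [code del]:
  "(uniformity :: (quat \<times> quat) filter) = (INF e\<in>{0 <..}. principal {(x, y). dist x y < e})"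
definition [code del]:
  "open (U :: quat set) \<longleftrightarrow> (\<forall>x\<in>U. eventually (\<lambda>(x', y). x' = x \<longrightarrow> y \<in> U) uniformity)"

instance
proof
  fix x y z :: quat and r :: real and U :: "quat set"
  show "inner x y = inner y x" "inner (x + y) z = inner x z + inner y z"
    "inner (r *\<^sub>R x) y = r * inner x y"
    by (simp_all add: inner_quat_def scaleR_quat_def algebra_simps)
  show "0 \<le> inner x x"
    by (simp add: inner_quat_def)
  show "inner x x = 0 \<longleftrightarrow> x = 0"
    by (simp add: inner_quat_def quat_eq_iff add_nonneg_eq_0_iff)
qed (rule norm_quat_def sgn_quat_def dist_quat_def uniformity_quat_def open_quat_def)+

end

instantiation quat :: real_normed_div_algebra
begin

definition "1 = Quat 1 0 0 0"
definition "x * y = Quat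
  (Q0 x * Q0 y - Q1 x * Q1 y - Q2 x * Q2 y - Q3 x * Q3 y)
  (Q0 x * Q1 y + Q1 x * Q0 y + Q2 x * Q3 y - Q3 x * Q2 y)
  (Q0 x * Q2 y - Q1 x * Q3 y + Q2 x * Q0 y + Q3 x * Q1 y)
  (Q0 x * Q3 y + Q1 x * Q2 y - Q2 x * Q1 y + Q3 x * Q0 y)"
definition "inverse x = Quat (Q0 x) (- Q1 x) (- Q2 x) (- Q3 x) /\<^sub>R inner x x"
definition "x div (y :: quat) = x * inverse y"

instance
proof
  fix x y z :: quat and r :: real
  show "x * y * z = x * (y * z)"
    by (simp add: quat_eq_iff times_quat_def algebra_simps)
  show "(x + y) * z = x * z + y * z"
    by (simp add: quat_eq_iff times_quat_def algebra_simps)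
  show "x * (y + z) = x * y + x * z"
    by (simp add: quat_eq_iff times_quat_def algebra_simps)
  show "1 * x = x" "x * 1 = x"
    by (simp_all add: quat_eq_iff times_quat_def one_quat_def)
  show "r *\<^sub>R x * y = r *\<^sub>R (x * y)"
    by (simp add: quat_eq_iff times_quat_def algebra_simps)
  show "x * r *\<^sub>R y = r *\<^sub>R (x * y)"
    by (simp add: quat_eq_iff times_quat_def algebra_simps)
  show "(0 :: quat) \<noteq> 1"
    by (simp add: quat_eq_iff one_quat_def)
  show "x div y = x * inverse y"
    by (rule divide_quat_def)
  show "inverse (0 :: quat) = 0"
    by (simp add: inverse_quat_def quat_eq_iff)
  show "inverse x * x = 1" "x * inverse x = 1" if "x \<noteq> 0"
  proof -
    have n: "inner x x \<noteq> 0"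
      using that by simp
    have "Q0 x * Q0 x + Q1 x * Q1 x + Q2 x * Q2 x + Q3 x * Q3 x = inner x x"
      by (simp add: inner_quat_def)
    then have i: "inverse (inner x x) * (Q0 x * Q0 x) + inverse (inner x x) * (Q1 x * Q1 x)
        + inverse (inner x x) * (Q2 x * Q2 x) + inverse (inner x x) * (Q3 x * Q3 x) = 1"
      using n by (metis distrib_left left_inverse)
    show "inverse x * x = 1" "x * inverse x = 1"
      using i by (simp_all add: quat_eq_iff times_quat_def one_quat_def inverse_quat_def algebra_simps)
  qed
  show "norm (x * y) = norm x * norm y"
  proof -
    have "inner (x * y) (x * y) = inner x x * inner y y"
      by (simp add: inner_quat_def times_quat_def algebra_simps)
    then show ?thesis
      by (simp add: norm_quat_def real_sqrt_mult)
  qed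
qed

end

definition quat_i :: quat where "quat_i = Quat 0 1 0 0"
definition quat_j :: quat where "quat_j = Quat 0 0 1 0"
definition quat_k :: quat where "quat_k = Quat 0 0 0 1"

lemma quat_units: "quat_i * quat_j = quat_k" "quat_j * quat_k = quat_i" "quat_k * quat_i = quat_j"
  "quat_i * quat_i = -1" "quat_j * quat_j = -1" "quat_k * quat_k = -1"
  by (simp_all add: quat_i_def quat_j_def quat_k_def quat_eq_iff times_quat_def one_quat_def)

instantiation quat :: euclidean_space
begin

definition "Basis = {1, quat_i, quat_j, quat_k}"

instance
proof
  fix x u v :: quat
  show "(Basis :: quat set) \<noteq> {}" "finite (Basis :: quat set)"
    by (simp_all add: Basis_quat_def)
  show "inner u v = (if u = v then 1 else 0)" if "u \<in> Basis" "v \<in> Basis"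
    using that unfolding Basis_quat_def
    by (elim insertE emptyE)
      (simp_all add: inner_quat_def one_quat_def quat_i_def quat_j_def quat_k_def)
  show "(\<forall>u\<in>Basis. inner x u = 0) \<longleftrightarrow> x = 0"
    unfolding quat_eq_iff[of x]
    by (simp add: Basis_quat_def inner_quat_def one_quat_def quat_i_def quat_j_def quat_k_def)
qed

end

section \<open>The group SL(n+1,H) and its projective action\<close>

definition quat_emb :: "quat \<Rightarrow> bool \<Rightarrow> bool \<Rightarrow> complex" where
  "quat_emb q r c = (case (r, c) of
      (False, False) \<Rightarrow> Complex (Q0 q) (Q1 q)
    | (False, True) \<Rightarrow> Complex (- Q2 q) (- Q3 q)
    | (True, False) \<Rightarrow> Complex (Q2 q) (- Q3 q)
    | (True, True) \<Rightarrow> Complex (Q0 q) (- Q1 q))"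

definition cmat :: "quat ^ 'k ^ 'k \<Rightarrow> complex ^ ('k \<times> bool) ^ ('k \<times> bool)" where
  "cmat A = (\<chi> r c. quat_emb (A $ fst r $ fst c) (snd r) (snd c))"

lemma quat_emb_mult: "quat_emb (p * q) r c = (\<Sum>s\<in>UNIV. quat_emb p r s * quat_emb q s c)"
  by (cases r; cases c)
    (simp_all add: quat_emb_def UNIV_bool times_quat_def complex_eq_iff)

definition SLH :: "(quat ^ 'k ^ 'k) set" where
  "SLH = {g. det (cmat g) = 1}"

(* (n+1) x (n+1) matrices are indexed by 'n option: None is the first row or column, Some the
   remaining n. *)
definition blk_a :: "quat ^ 'n::finite option ^ 'n option \<Rightarrow> quat" where
  "blk_a h = h $ None $ None"
definition blk_b :: "quat ^ 'n::finite option ^ 'n option \<Rightarrow> quat ^ 'n" where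
  "blk_b h = (\<chi> j. h $ None $ Some j)"
definition blk_c :: "quat ^ 'n::finite option ^ 'n option \<Rightarrow> quat ^ 'n" where
  "blk_c h = (\<chi> i. h $ Some i $ None)"
definition blk_d :: "quat ^ 'n::finite option ^ 'n option \<Rightarrow> quat ^ 'n ^ 'n" where
  "blk_d h = (\<chi> i j. h $ Some i $ Some j)"

(* a + b q for a matrix with first block row (a, b) *)
definition pdenom :: "quat ^ 'n::finite option ^ 'n option \<Rightarrow> quat ^ 'n \<Rightarrow> quat" where
  "pdenom h q = blk_a h + (\<Sum>j\<in>UNIV. blk_b h $ j * q $ j)"

(* h.q = (c + d q) (a + b q)^{-1}; meaningful only where pdenom h q is nonzero *)
definition pact :: "quat ^ 'n::finite option ^ 'n option \<Rightarrow> quat ^ 'n \<Rightarrow> quat ^ 'n" where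
  "pact h q = (\<chi> i. (blk_c h + blk_d h *v q) $ i * inverse (pdenom h q))"

section \<open>Quaternionic projective flat manifolds and sections of R[-1]\<close>

primrec Ck_on :: "nat \<Rightarrow> 'a::real_normed_vector set \<Rightarrow> ('a \<Rightarrow> 'b::real_normed_vector) \<Rightarrow> bool" where
  "Ck_on 0 S f \<longleftrightarrow> continuous_on S f"
| "Ck_on (Suc k) S f \<longleftrightarrow> (\<forall>x\<in>S. f differentiable at x) \<and>
     (\<forall>v. Ck_on k S (\<lambda>x. frechet_derivative f (at x) v))"

(* intended for open S *)
definition smooth_on :: "'a::real_normed_vector set \<Rightarrow> ('a \<Rightarrow> 'b::real_normed_vector) \<Rightarrow> bool" where
  "smooth_on S f \<longleftrightarrow> (\<forall>k. Ck_on k S f)"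

(* M is covered by the charts (U \<alpha>, \<phi> \<alpha>), \<alpha> \<in> I, and the transition map
   from \<phi> \<alpha> to \<phi> \<beta> is the action of the inverse of g \<alpha> \<beta>.
   The transition maps are automatically smooth. *)
definition qp_flat_atlas ::
  "'m topology \<Rightarrow> 'i set \<Rightarrow> ('i \<Rightarrow> 'm set) \<Rightarrow> ('i \<Rightarrow> 'm \<Rightarrow> quat ^ 'n::finite)
    \<Rightarrow> ('i \<Rightarrow> 'i \<Rightarrow> quat ^ 'n option ^ 'n option) \<Rightarrow> bool" where
  "qp_flat_atlas M I U \<phi> g \<longleftrightarrow>
     Hausdorff_space M \<and> second_countable M \<and>
     (\<Union>\<alpha>\<in>I. U \<alpha>) = topspace M \<and>
     (\<forall>\<alpha>\<in>I. openin M (U \<alpha>) \<and> open (\<phi> \<alpha> ` U \<alpha>) \<and>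
        homeomorphic_map (subtopology M (U \<alpha>)) (top_of_set (\<phi> \<alpha> ` U \<alpha>)) (\<phi> \<alpha>)) \<and>
     (\<forall>\<alpha>\<in>I. \<forall>\<beta>\<in>I. g \<alpha> \<beta> \<in> SLH \<and>
        (\<forall>q \<in> \<phi> \<alpha> ` (U \<alpha> \<inter> U \<beta>).
           pdenom (matrix_inv (g \<alpha> \<beta>)) q \<noteq> 0 \<and>
           \<phi> \<beta> (inv_into (U \<alpha>) (\<phi> \<alpha>) q) = pact (matrix_inv (g \<alpha> \<beta>)) q))"

definition smooth_section ::
  "'i set \<Rightarrow> ('i \<Rightarrow> 'm set) \<Rightarrow> ('i \<Rightarrow> 'm \<Rightarrow> quat ^ 'n::finite)
    \<Rightarrow> ('i \<Rightarrow> 'i \<Rightarrow> quat ^ 'n option ^ 'n option) \<Rightarrow> ('i \<Rightarrow> quat ^ 'n \<Rightarrow> real) \<Rightarrow> bool" where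
  "smooth_section I U \<phi> g u \<longleftrightarrow>
     (\<forall>\<alpha>\<in>I. smooth_on (\<phi> \<alpha> ` U \<alpha>) (u \<alpha>)) \<and>
     (\<forall>\<alpha>\<in>I. \<forall>\<beta>\<in>I. \<forall>q \<in> \<phi> \<alpha> ` (U \<alpha> \<inter> U \<beta>).
        u \<alpha> q = inverse ((norm (pdenom (matrix_inv (g \<alpha> \<beta>)) q))\<^sup>2)
                 * u \<beta> (pact (matrix_inv (g \<alpha> \<beta>)) q))"

section \<open>The exterior algebra\<close>

(* The generators are indexed by 'n \<times> bool instead of 0, ..., 2n-1: the (l+1)-st element x of 'n
   gives (x, False) for 2l and (x, True) for 2l+1. A form is the family of its coefficients on the
   products of generators, each product taken in increasing index order. *)
type_synonym 'n form = "('n \<times> bool) set \<Rightarrow> complex"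

definition idx_less :: "'n::linorder \<times> bool \<Rightarrow> 'n \<times> bool \<Rightarrow> bool" where
  "idx_less A B \<longleftrightarrow> fst A < fst B \<or> fst A = fst B \<and> snd A < snd B"

(* sign of the permutation sorting the increasing enumeration of J followed by that of K *)
definition shuffle_sign :: "('n::linorder \<times> bool) set \<Rightarrow> ('n \<times> bool) set \<Rightarrow> complex" where
  "shuffle_sign J K = (-1) ^ card {(A, B). A \<in> J \<and> B \<in> K \<and> idx_less B A}"

definition wedge :: "'n::{finite,linorder} form \<Rightarrow> 'n form \<Rightarrow> 'n form" (infixr "\<and>\<^sub>f" 70) where
  "F \<and>\<^sub>f G = (\<lambda>L. \<Sum>J\<in>Pow L. shuffle_sign J (L - J) * F J * G (L - J))"

definition form_const :: "complex \<Rightarrow> 'n form" where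
  "form_const c = (\<lambda>J. if J = {} then c else 0)"

definition gen :: "'n \<times> bool \<Rightarrow> 'n form" where
  "gen A = (\<lambda>J. if J = {A} then 1 else 0)"

definition wedge_power :: "'n::{finite,linorder} form \<Rightarrow> nat \<Rightarrow> 'n form" where
  "wedge_power F k = (wedge F ^^ k) (form_const 1)"

definition Omega :: "'n::{finite,linorder} form" where
  "Omega = foldr wedge
     (map gen (concat (map (\<lambda>l. [(l, False), (l, True)]) (sorted_list_of_set UNIV)))) (form_const 1)"

section \<open>The quaternionic Monge-Ampere operator\<close>

(* partial derivative in the real coordinate of the l-th quaternionic variable
   belonging to the unit e \<in> {1, i, j, k} *)
definition pderiv_at :: "'n::finite \<Rightarrow> quat \<Rightarrow> (quat ^ 'n \<Rightarrow> complex) \<Rightarrow> quat ^ 'n \<Rightarrow> complex" where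
  "pderiv_at l e f q = vector_derivative (\<lambda>t. f (q + t *\<^sub>R axis l e)) (at 0)"

(* first argument: False for the upper index 0', True for 1' *)
fun nabla :: "bool \<Rightarrow> 'n::finite \<times> bool \<Rightarrow> (quat ^ 'n \<Rightarrow> complex) \<Rightarrow> quat ^ 'n \<Rightarrow> complex" where
  "nabla False (l, False) f q = (pderiv_at l 1 f q - \<i> * pderiv_at l quat_i f q) / 2"
| "nabla False (l, True) f q = (pderiv_at l quat_j f q + \<i> * pderiv_at l quat_k f q) / 2"
| "nabla True (l, False) f q = (- pderiv_at l quat_j f q + \<i> * pderiv_at l quat_k f q) / 2"
| "nabla True (l, True) f q = (pderiv_at l 1 f q + \<i> * pderiv_at l quat_i f q) / 2"

definition dform ::
  "bool \<Rightarrow> (quat ^ 'n::{finite,linorder} \<Rightarrow> 'n form) \<Rightarrow> quat ^ 'n::{finite,linorder} \<Rightarrow> 'n form" where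
  "dform A' F q = (\<lambda>L. \<Sum>A\<in>UNIV. (gen A \<and>\<^sub>f (\<lambda>J. nabla A' A (\<lambda>p. F p J) q)) L)"

definition triangle_op ::
  "(quat ^ 'n::{finite,linorder} \<Rightarrow> complex) \<Rightarrow> quat ^ 'n::{finite,linorder} \<Rightarrow> 'n form" where
  "triangle_op v = dform False (dform True (\<lambda>q. form_const (v q)))"

definition MA ::
  "(quat ^ 'n::{finite,linorder} \<Rightarrow> complex) \<Rightarrow> quat ^ 'n::{finite,linorder} \<Rightarrow> complex" where
  "MA v q = (THE c. wedge_power (triangle_op v q) CARD('n) = (\<lambda>L. c * Omega L))"

text \<open>The coefficient in the definition of \<^const>\<open>MA\<close> exists and is unique.\<close>

lemma wedge_support:
  assumes "\<And>L. F L \<noteq> 0 \<Longrightarrow> card L = k" and "\<And>L. G L \<noteq> 0 \<Longrightarrow> card L = m"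
    and "(F \<and>\<^sub>f G) L \<noteq> 0"
  shows "card L = k + m"
proof -
  obtain J where J: "J \<subseteq> L" "F J \<noteq> 0" "G (L - J) \<noteq> 0"
    using assms(3) unfolding wedge_def by (auto elim!: sum.not_neutral_contains_not_neutral)
  have "card L = card J + card (L - J)"
    using J(1) by (simp add: card_Diff_subset card_mono finite_subset[OF _ finite])
  then show ?thesis
    using assms(1)[OF J(2)] assms(2)[OF J(3)] by simp
qed

lemma dform_support:
  assumes "\<And>p L. F p L \<noteq> 0 \<Longrightarrow> card L = k" and "dform A' F q L \<noteq> 0"
  shows "card L = Suc k"
proof -
  obtain A where A: "(gen A \<and>\<^sub>f (\<lambda>J. nabla A' A (\<lambda>p. F p J) q)) L \<noteq> 0"
    using assms(2) unfolding dform_def by (auto elim!: sum.not_neutral_contains_not_neutral)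
  have z: "nabla A' A (\<lambda>p. 0) q = 0"
    by (cases A'; cases A; cases "snd A") (simp_all add: pderiv_at_def)
  have "card J = k" if "nabla A' A (\<lambda>p. F p J) q \<noteq> 0" for J
  proof (rule ccontr)
    assume "card J \<noteq> k"
    then have "(\<lambda>p. F p J) = (\<lambda>p. 0)"
      using assms(1) by blast
    with that z show False
      by simp
  qed
  moreover have "card J = 1" if "gen A J \<noteq> 0" for J
    using that by (auto simp: gen_def split: if_split_asm)
  ultimately show ?thesis
    using wedge_support[OF _ _ A] by fastforce
qed

lemma triangle_op_support:
  assumes "triangle_op v q L \<noteq> 0"
  shows "card L = 2"
proof -
  have 0: "form_const (v p) J \<noteq> 0 \<Longrightarrow> card J = 0" for p and J :: "('a \<times> bool) set"
    by (auto simp: form_const_def split: if_split_asm)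
  have "dform True (\<lambda>q. form_const (v q)) p J \<noteq> 0 \<Longrightarrow> card J = Suc 0" for p J
    using dform_support[OF 0] .
  from dform_support[OF this assms[unfolded triangle_op_def]] show ?thesis
    by simp
qed

lemma wedge_power_support:
  assumes "\<And>L. F L \<noteq> 0 \<Longrightarrow> card L = 2" and "wedge_power F k L \<noteq> 0"
  shows "card L = 2 * k"
  using assms(2)
proof (induction k arbitrary: L)
  case 0
  then show ?case
    by (auto simp: wedge_power_def form_const_def split: if_split_asm)
next
  case (Suc k)
  have "(F \<and>\<^sub>f wedge_power F k) L \<noteq> 0"
    using Suc.prems by (simp add: wedge_power_def)
  from wedge_support[OF assms(1) Suc.IH this] show ?case
    by simp
qed

lemma gen_wedge:
  "(gen A \<and>\<^sub>f F) L = (if A \<in> L then shuffle_sign {A} (L - {A}) * F (L - {A}) else 0)"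
proof -
  have "(gen A \<and>\<^sub>f F) L =
      (\<Sum>J\<in>Pow L. if J = {A} then shuffle_sign {A} (L - {A}) * F (L - {A}) else 0)"
    unfolding wedge_def by (rule sum.cong) (auto simp: gen_def)
  then show ?thesis
    by simp
qed

lemma foldr_gen:
  assumes "distinct xs"
  shows "\<exists>s. s \<noteq> 0 \<and> foldr wedge (map gen xs) (form_const 1) = (\<lambda>L. if L = set xs then s else 0)"
  using assms
proof (induction xs)
  case Nil
  show ?case
    by (auto simp: form_const_def intro!: exI[of _ 1])
next
  case (Cons A xs)
  then obtain s where s: "s \<noteq> 0"
    "foldr wedge (map gen xs) (form_const 1) = (\<lambda>L. if L = set xs then s else 0)"
    by auto
  have e: "A \<in> L \<and> L - {A} = set xs \<longleftrightarrow> L = set (A # xs)" for L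
    using Cons.prems by auto
  have "foldr wedge (map gen (A # xs)) (form_const 1)
      = (\<lambda>L. if L = set (A # xs) then shuffle_sign {A} (set xs) * s else 0)"
  proof
    fix L
    show "foldr wedge (map gen (A # xs)) (form_const 1) L
      = (if L = set (A # xs) then shuffle_sign {A} (set xs) * s else 0)"
      using e[of L] by (auto simp: s gen_wedge)
  qed
  moreover have "shuffle_sign {A} (set xs) * s \<noteq> 0"
    using s(1) by (simp add: shuffle_sign_def)
  ultimately show ?case
    by blast
qed

lemma Omega_top: "\<exists>s. s \<noteq> 0 \<and> Omega = (\<lambda>L. if L = UNIV then s else 0)"
proof -
  define xs where "xs = concat (map (\<lambda>l::'a. [(l, False), (l, True)]) (sorted_list_of_set UNIV))"
  have "distinct (concat (map (\<lambda>l. [(l, False), (l, True)]) ys))" if "distinct ys" for ys :: "'a list"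
    using that by (induction ys) auto
  then have "distinct xs"
    by (simp add: xs_def)
  moreover have "set xs = UNIV"
  proof -
    have "(l, b) \<in> set xs" for l b
      by (cases b) (auto simp: xs_def)
    then show ?thesis
      by auto
  qed
  ultimately show ?thesis
    using foldr_gen[of xs] by (simp add: Omega_def xs_def)
qed

lemma MA_ex1: "\<exists>!c. wedge_power (triangle_op v q) CARD('n) = (\<lambda>L. c * Omega L)"
  for v :: "quat ^ 'n::{finite,linorder} \<Rightarrow> complex"
proof -
  obtain s where s: "s \<noteq> 0" "(Omega :: 'n form) = (\<lambda>L. if L = UNIV then s else 0)"
    using Omega_top by blast
  have "L = UNIV" if "wedge_power (triangle_op v q) CARD('n) L \<noteq> 0" for L
  proof -
    have "card L = 2 * CARD('n)"
      by (rule wedge_power_support[OF triangle_op_support that])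
    also have "\<dots> = CARD('n \<times> bool)"
      by simp
    finally show ?thesis
      by (metis card_eq_UNIV_imp_eq_UNIV finite_class.finite_UNIV)
  qed
  then have "wedge_power (triangle_op v q) CARD('n)
      = (\<lambda>L. wedge_power (triangle_op v q) CARD('n) UNIV / s * Omega L)"
    using s(1) by (intro ext) (auto simp: s(2))
  moreover have "c = d" if "(\<lambda>L. c * (Omega :: 'n form) L) = (\<lambda>L. d * Omega L)" for c d
    using fun_cong[OF that, of UNIV] s(1) unfolding s(2) by simp
  ultimately show ?thesis
    by metis
qed

end

theory Submission
  imports Defs
begin

text \<open>Fix a transition map \<open>q \<mapsto> h.q\<close> with \<open>h\<close> the inverse of a matrix in \<open>SL(n+1,H)\<close>, and write
\<open>s = a + b q\<close>, \<open>p = h.q\<close> and \<open>u = |s|^{-2} (v o h)\<close>. Everything follows from the transformation law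
\<open>M(u)(q) = |s|^{-2(2n+1)} M(v)(p)\<close> (lemma \<open>MA_weighted_pullback\<close>): the numerator and the denominator of
\<open>M(u) / u^{2n+1}\<close> pick up the same factor. The reasons for this law are the following.

The differential of \<open>h\<close> at \<open>q\<close> is \<open>X \<mapsto> W X s^{-1}\<close> with \<open>W = d - p b\<close>. Each \<open>\<nabla>\<close> with indices \<open>A', A\<close>
differentiates in the direction of a complexified vector; left multiplication by a quaternionic matrix
acts on these vectors through the index \<open>A\<close> alone, right multiplication by a quaternion through
\<open>A'\<close> alone (\<open>symbol_mult_vector\<close>, \<open>symbol_vmult_right\<close>). The two-form \<open>\<triangle>u\<close> has the
coefficients \<open>t A B = \<nabla>^{0'}_A \<nabla>^{1'}_B u\<close>, of which only the part antisymmetric in \<open>A\<close> and \<open>B\<close> matters.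

In the second derivative of \<open>u\<close>, the terms that contain \<open>v\<close> or a first derivative of \<open>v\<close> contribute
something symmetric in \<open>A\<close> and \<open>B\<close>, so they disappear; this is where the weight \<open>-2\<close> enters
(\<open>lower_order_symmetric\<close>). In the remaining term the second derivative of \<open>v\<close> is evaluated on
\<open>W X s^{-1}\<close> and \<open>W Y s^{-1}\<close>. Because it is a symmetric bilinear form (\<open>second_deriv_symmetric\<close>), antisymmetry
in \<open>A, B\<close> is antisymmetry in \<open>0', 1'\<close>, hence the right factor \<open>s^{-1}\<close> contributes the determinant
\<open>|s|^{-2}\<close> of its two by two complex matrix, and the left factor \<open>W\<close> amounts to the linear substitution of the
generators by the complex matrix of \<open>W\<close> (\<open>symbol_symbol_pact_deriv\<close>). Together with the factor
\<open>|s|^{-2}\<close> in \<open>u\<close>, the two-form \<open>\<triangle>u\<close> is \<open>|s|^{-4}\<close> times the substituted \<open>\<triangle>v\<close>.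

A linear substitution multiplies the \<open>n\<close>-th power of a two-form, a top-degree form, by the determinant
(\<open>wedge_power_subst_gen\<close>), so \<open>M(u) = |s|^{-4n} det W M(v)\<close>. Block elimination in \<open>h\<close> gives
\<open>|s|^2 det W = det h = 1\<close> (\<open>det_pact_factor\<close>), and the exponent becomes \<open>-4n - 2\<close>.\<close>

section \<open>Words in anticommuting one-forms\<close>

lemma shuffle_sign_Un_left:
  assumes "J \<inter> J' = {}"
  shows "shuffle_sign (J \<union> J') (K :: ('n::{finite,linorder} \<times> bool) set)
    = shuffle_sign J K * shuffle_sign J' K"
proof -
  have "{(A, B). A \<in> J \<union> J' \<and> B \<in> K \<and> idx_less B A}
      = {(A, B). A \<in> J \<and> B \<in> K \<and> idx_less B A} \<union> {(A, B). A \<in> J' \<and> B \<in> K \<and> idx_less B A}"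
    by auto
  moreover have "card \<dots> = card {(A, B). A \<in> J \<and> B \<in> K \<and> idx_less B A}
      + card {(A, B). A \<in> J' \<and> B \<in> K \<and> idx_less B A}"
    using assms by (intro card_Un_disjoint) auto
  ultimately show ?thesis
    unfolding shuffle_sign_def by (simp add: power_add)
qed

lemma shuffle_sign_Un_right:
  assumes "K \<inter> K' = {}"
  shows "shuffle_sign (J :: ('n::{finite,linorder} \<times> bool) set) (K \<union> K')
    = shuffle_sign J K * shuffle_sign J K'"
proof -
  have "{(A, B). A \<in> J \<and> B \<in> K \<union> K' \<and> idx_less B A}
      = {(A, B). A \<in> J \<and> B \<in> K \<and> idx_less B A} \<union> {(A, B). A \<in> J \<and> B \<in> K' \<and> idx_less B A}"
    by auto
  moreover have "card \<dots> = card {(A, B). A \<in> J \<and> B \<in> K \<and> idx_less B A}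
      + card {(A, B). A \<in> J \<and> B \<in> K' \<and> idx_less B A}"
    using assms by (intro card_Un_disjoint) auto
  ultimately show ?thesis
    unfolding shuffle_sign_def by (simp add: power_add)
qed

lemma shuffle_sign_singletons: "shuffle_sign {A} {B} = (if idx_less B A then -1 else 1)"
proof -
  have "{(A', B'). A' \<in> {A} \<and> B' \<in> {B} \<and> idx_less B' A'} = (if idx_less B A then {(A, B)} else {})"
    by auto
  then show ?thesis
    by (simp add: shuffle_sign_def)
qed

lemma shuffle_sign_swap:
  assumes "A \<noteq> (B :: 'n::linorder \<times> bool)"
  shows "shuffle_sign {A} {B} = - shuffle_sign {B} {A}"
proof -
  have "idx_less A B \<longleftrightarrow> \<not> idx_less B A"
    using assms by (cases A; cases B) (auto simp: idx_less_def)
  then show ?thesis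
    by (simp add: shuffle_sign_singletons)
qed

lemma wedge_sum_left:
  "(\<lambda>L. \<Sum>i\<in>S. c i * F i L) \<and>\<^sub>f G = (\<lambda>L. \<Sum>i\<in>S. c i * (F i \<and>\<^sub>f G) L)"
  unfolding wedge_def
  by (rule ext, simp add: sum_distrib_left sum_distrib_right mult_ac, subst sum.swap, simp)

lemma wedge_sum_right:
  "F \<and>\<^sub>f (\<lambda>L. \<Sum>i\<in>S. c i * G i L) = (\<lambda>L. \<Sum>i\<in>S. c i * (F \<and>\<^sub>f G i) L)"
  unfolding wedge_def
  by (rule ext, simp add: sum_distrib_left sum_distrib_right mult_ac, subst sum.swap, simp)

lemma wedge_scale_left: "(\<lambda>L. c * F L) \<and>\<^sub>f G = (\<lambda>L. c * (F \<and>\<^sub>f G) L)"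
  unfolding wedge_def by (simp add: sum_distrib_left mult_ac)

lemma wedge_scale_right: "F \<and>\<^sub>f (\<lambda>L. c * G L) = (\<lambda>L. c * (F \<and>\<^sub>f G) L)"
  unfolding wedge_def by (simp add: sum_distrib_left mult_ac)

text \<open>Splitting off the generator \<open>A\<close> is a bijection between the parts of \<open>L\<close> that contain \<open>A\<close> and the parts of
\<open>L - {A}\<close>; both sides then carry the same signs because \<^const>\<open>shuffle_sign\<close> is multiplicative in each
argument.\<close>

lemma gen_wedge_assoc: "(gen A \<and>\<^sub>f G) \<and>\<^sub>f F = gen A \<and>\<^sub>f (G \<and>\<^sub>f F)"
proof
  fix L
  let ?h = "\<lambda>J. shuffle_sign J (L - J) * (gen A \<and>\<^sub>f G) J * F (L - J)"
  have lhs: "((gen A \<and>\<^sub>f G) \<and>\<^sub>f F) L = (\<Sum>J\<in>{J\<in>Pow L. A \<in> J}. ?h J)"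
    unfolding wedge_def[of "gen A \<and>\<^sub>f G"]
    by (rule sum.mono_neutral_right) (auto simp: gen_wedge)
  show "((gen A \<and>\<^sub>f G) \<and>\<^sub>f F) L = (gen A \<and>\<^sub>f (G \<and>\<^sub>f F)) L"
  proof (cases "A \<in> L")
    case False
    then have "{J\<in>Pow L. A \<in> J} = {}"
      by auto
    with False show ?thesis
      by (simp only: lhs gen_wedge) simp
  next
    case True
    have "(\<Sum>J\<in>{J\<in>Pow L. A \<in> J}. ?h J) = (\<Sum>K\<in>Pow (L - {A}). ?h (insert A K))"
      by (rule sum.reindex_bij_witness[of _ "insert A" "\<lambda>J. J - {A}"])
         (use True in \<open>auto simp: insert_absorb\<close>)
    also have "\<dots> = (\<Sum>K\<in>Pow (L - {A}). shuffle_sign {A} (L - {A}) *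
        (shuffle_sign K (L - {A} - K) * G K * F (L - {A} - K)))"
    proof (rule sum.cong)
      fix K assume "K \<in> Pow (L - {A})"
      then have K: "A \<notin> K" "K \<subseteq> L - {A}"
        by auto
      define R where "R = L - {A} - K"
      have R: "L - insert A K = R" "L - {A} = K \<union> R" "insert A K = {A} \<union> K"
          "{A} \<union> K - {A} = K" "K \<inter> R = {}" "{A} \<inter> K = {}"
        using K unfolding R_def by auto
      show "?h (insert A K) = shuffle_sign {A} (L - {A}) *
          (shuffle_sign K (L - {A} - K) * G K * F (L - {A} - K))"
        unfolding R_def[symmetric] gen_wedge R(1)
        unfolding R(2,3) shuffle_sign_Un_left[OF R(6)] shuffle_sign_Un_right[OF R(5)] R(4)
        by simp
    qed simp
    finally show ?thesis
      unfolding lhs gen_wedge using True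
      by (simp add: sum_distrib_left wedge_def[of G])
  qed
qed

lemma gen_anticommute: "gen A \<and>\<^sub>f (gen B \<and>\<^sub>f F) = (\<lambda>L. - (gen B \<and>\<^sub>f (gen A \<and>\<^sub>f F)) L)"
proof
  fix L
  show "(gen A \<and>\<^sub>f (gen B \<and>\<^sub>f F)) L = - (gen B \<and>\<^sub>f (gen A \<and>\<^sub>f F)) L"
  proof (cases "A \<noteq> B \<and> A \<in> L \<and> B \<in> L")
    case False
    then show ?thesis
      by (auto simp: gen_wedge)
  next
    case True
    define R where "R = L - {A} - {B}"
    have R: "L - {A} = {B} \<union> R" "L - {B} = {A} \<union> R" "{B} \<inter> R = {}" "{A} \<inter> R = {}"
        "{B} \<union> R - {B} = R" "{A} \<union> R - {A} = R"
      using True by (auto simp: R_def)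
    show ?thesis
      using True shuffle_sign_swap[of A B]
      unfolding gen_wedge R(1,2) shuffle_sign_Un_right[OF R(3)] shuffle_sign_Un_right[OF R(4)] R(5,6)
      by simp
  qed
qed

text \<open>A word is a product of one-forms from a family \<open>\<theta>\<close>, multiplied onto a form from the left. The lemmas
on reordered words and on repeated letters assume only that left multiplications by members of \<open>\<theta>\<close>
anticommute, because they are applied to the generators and also to their images under a linear
substitution.\<close>

abbreviation wedge_word ::
    "('n::{finite,linorder} \<times> bool \<Rightarrow> 'n form) \<Rightarrow> ('n \<times> bool) list \<Rightarrow> 'n form \<Rightarrow> 'n form" where
  "wedge_word \<theta> w F \<equiv> foldr wedge (map \<theta> w) F"

lemma wedge_word_scale: "wedge_word \<theta> w (\<lambda>L. c * F L) = (\<lambda>L. c * wedge_word \<theta> w F L)"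
  by (induction w) (simp_all add: wedge_scale_right)

lemma wedge_word_neg: "wedge_word \<theta> w (\<lambda>L. - F L) = (\<lambda>L. - wedge_word \<theta> w F L)"
  using wedge_word_scale[of \<theta> w "-1" F] by simp

lemma wedge_word_sum:
  "wedge_word \<theta> w (\<lambda>L. \<Sum>i\<in>S. c i * F i L) = (\<lambda>L. \<Sum>i\<in>S. c i * wedge_word \<theta> w (F i) L)"
  by (induction w) (simp_all add: wedge_sum_right)

lemma wedge_word_move:
  assumes anti: "\<And>A B F. \<theta> A \<and>\<^sub>f (\<theta> B \<and>\<^sub>f F) = (\<lambda>L. - (\<theta> B \<and>\<^sub>f (\<theta> A \<and>\<^sub>f F)) L)"
  shows "\<theta> a \<and>\<^sub>f wedge_word \<theta> w F = (\<lambda>L. (-1) ^ length w * wedge_word \<theta> w (\<theta> a \<and>\<^sub>f F) L)"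
proof (induction w)
  case (Cons b w)
  have "\<theta> a \<and>\<^sub>f wedge_word \<theta> (b # w) F = (\<lambda>L. - (\<theta> b \<and>\<^sub>f (\<theta> a \<and>\<^sub>f wedge_word \<theta> w F)) L)"
    using anti[of a b] by simp
  then show ?case
    unfolding Cons by (simp add: wedge_scale_right)
qed simp

text \<open>Carrying \<open>\<theta> a\<close> and \<open>\<theta> b\<close> across the word \<open>y\<close> between them costs the sign
\<open>(-1) ^ length y\<close> on either side, so the two signs cancel and a single anticommutation remains.\<close>

lemma wedge_word_swap:
  assumes anti: "\<And>A B F. \<theta> A \<and>\<^sub>f (\<theta> B \<and>\<^sub>f F) = (\<lambda>L. - (\<theta> B \<and>\<^sub>f (\<theta> A \<and>\<^sub>f F)) L)"
  shows "wedge_word \<theta> (x @ a # y @ b # z) F = (\<lambda>L. - wedge_word \<theta> (x @ b # y @ a # z) F L)"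
proof -
  let ?Z = "wedge_word \<theta> z F"
  note move = wedge_word_move[where \<theta> = \<theta>, OF anti]
  have "\<theta> a \<and>\<^sub>f wedge_word \<theta> y (\<theta> b \<and>\<^sub>f ?Z)
      = (\<lambda>L. - (\<theta> b \<and>\<^sub>f wedge_word \<theta> y (\<theta> a \<and>\<^sub>f ?Z)) L)"
    unfolding move[of a y] move[of b y] anti[of a b ?Z] wedge_word_neg by simp
  then show ?thesis
    by (simp add: wedge_word_neg)
qed

text \<open>Exchanging the two equal letters leaves the word unchanged and changes its sign.\<close>

lemma wedge_word_not_distinct:
  assumes anti: "\<And>A B F. \<theta> A \<and>\<^sub>f (\<theta> B \<and>\<^sub>f F) = (\<lambda>L. - (\<theta> B \<and>\<^sub>f (\<theta> A \<and>\<^sub>f F)) L)"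
    and "\<not> distinct w"
  shows "wedge_word \<theta> w F = (\<lambda>L. 0)"
proof -
  obtain x a y z where w: "w = x @ a # y @ a # z"
    using not_distinct_decomp[OF assms(2)] by auto
  show ?thesis
  proof
    fix L
    have "wedge_word \<theta> w F L = - wedge_word \<theta> w F L"
      using fun_cong[OF wedge_word_swap[where \<theta> = \<theta>, OF anti, of x a y a z F], of L] w by simp
    then show "wedge_word \<theta> w F L = 0"
      by simp
  qed
qed

lemma wedge_word_transpose:
  assumes anti: "\<And>A B F. \<theta> A \<and>\<^sub>f (\<theta> B \<and>\<^sub>f F) = (\<lambda>L. - (\<theta> B \<and>\<^sub>f (\<theta> A \<and>\<^sub>f F)) L)"
    and w: "distinct w" "a \<in> set w" "b \<in> set w" "a \<noteq> b"
  shows "wedge_word \<theta> (map (Transposition.transpose a b) w) F = (\<lambda>L. - wedge_word \<theta> w F L)"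
proof -
  have *: "wedge_word \<theta> (map (Transposition.transpose a b) w) F = (\<lambda>L. - wedge_word \<theta> w F L)"
    if eq: "w = x @ a # y @ b # z" for a b x y z
  proof -
    have id: "map (Transposition.transpose a b) v = v" if "a \<notin> set v" "b \<notin> set v" for v
      using that by (induction v) (auto simp: Transposition.transpose_def)
    have "map (Transposition.transpose a b) w = x @ b # y @ a # z"
      using w(1) by (simp add: eq id)
    then show ?thesis
      unfolding eq using wedge_word_swap[where \<theta> = \<theta>, OF anti, of x b y a z F] by simp
  qed
  obtain x y' where x: "w = x @ a # y'"
    using w(2) by (meson split_list)
  show ?thesis
  proof (cases "b \<in> set x")
    case True
    then obtain x1 x2 where "x = x1 @ b # x2"
      by (meson split_list)
    then have "w = x1 @ b # x2 @ a # y'"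
      using x by simp
    from *[OF this] show ?thesis
      by (simp add: transpose_commute)
  next
    case False
    with x w(3,4) have "b \<in> set y'"
      by auto
    then obtain y1 y2 where "y' = y1 @ b # y2"
      by (meson split_list)
    then have "w = x @ a # y1 @ b # y2"
      using x by simp
    from *[OF this] show ?thesis .
  qed
qed

text \<open>Induction on the transpositions that make up \<open>p\<close>.\<close>

lemma wedge_word_permute:
  assumes anti: "\<And>A B F. \<theta> A \<and>\<^sub>f (\<theta> B \<and>\<^sub>f F) = (\<lambda>L. - (\<theta> B \<and>\<^sub>f (\<theta> A \<and>\<^sub>f F)) L)"
    and w: "distinct w" "set w = UNIV" and p: "p permutes UNIV"
  shows "wedge_word \<theta> (map p w) F = (\<lambda>L. of_int (sign p) * wedge_word \<theta> w F L)"
  using p finite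
proof (induction rule: permutes_induct)
  case id
  then show ?case
    by simp
next
  case (swap a b p)
  have bij: "bij p"
    using swap.hyps(4) by (rule permutes_bij)
  have d: "distinct (map p w)" "set (map p w) = UNIV"
    using w bij by (auto simp: distinct_map bij_def intro: inj_on_subset)
  have "sign (Transposition.transpose a b \<circ> p) = - sign p"
    using swap.hyps(3,4) permutation_permutes[of p]
    by (subst sign_compose) (auto simp: sign_swap_id permutation_swap_id)
  moreover have "wedge_word \<theta> (map (Transposition.transpose a b \<circ> p) w) F
      = (\<lambda>L. - wedge_word \<theta> (map p w) F L)"
    using wedge_word_transpose[where \<theta> = \<theta>, OF anti d(1), of a b F] d(2) swap.hyps(3)
    by (simp add: o_def)
  ultimately show ?case
    using swap.IH by (simp add: o_def)
qed

text \<open>The substitution \<open>\<omega>\<^sup>C \<mapsto> \<Sum>A. W\<^sub>C\<^sub>A \<omega>\<^sup>A\<close> of the generators. The index that is summed over is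
the column, because this is the form in which the matrix of a linear map appears when it is applied before
taking derivatives.\<close>

definition subst_gen :: "complex ^ ('n \<times> bool) ^ ('n \<times> bool) \<Rightarrow> 'n::{finite,linorder} \<times> bool \<Rightarrow> 'n form"
  where "subst_gen W C = (\<lambda>L. \<Sum>A\<in>UNIV. W $ C $ A * gen A L)"

lemma subst_gen_wedge: "subst_gen W C \<and>\<^sub>f F = (\<lambda>L. \<Sum>A\<in>UNIV. W $ C $ A * (gen A \<and>\<^sub>f F) L)"
  unfolding subst_gen_def by (rule wedge_sum_left)

lemma subst_gen_anticommute:
  "subst_gen W A \<and>\<^sub>f (subst_gen W B \<and>\<^sub>f F) = (\<lambda>L. - (subst_gen W B \<and>\<^sub>f (subst_gen W A \<and>\<^sub>f F)) L)"
proof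
  fix L
  have *: "(subst_gen W A \<and>\<^sub>f (subst_gen W B \<and>\<^sub>f F)) L
      = (\<Sum>C\<in>UNIV. \<Sum>D\<in>UNIV. W $ A $ C * W $ B $ D * (gen C \<and>\<^sub>f (gen D \<and>\<^sub>f F)) L)" for A B
    unfolding subst_gen_wedge wedge_sum_right
    by (subst sum.swap) (simp add: sum_distrib_left mult_ac)
  have "(subst_gen W A \<and>\<^sub>f (subst_gen W B \<and>\<^sub>f F)) L
      = (\<Sum>C\<in>UNIV. \<Sum>D\<in>UNIV. - (W $ B $ D * W $ A $ C * (gen D \<and>\<^sub>f (gen C \<and>\<^sub>f F)) L))"
    unfolding * by (subst gen_anticommute) (simp add: mult_ac)
  also have "\<dots> = - (subst_gen W B \<and>\<^sub>f (subst_gen W A \<and>\<^sub>f F)) L"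
    unfolding *[of B A] by (subst sum.swap) (simp add: sum_negf)
  finally show "(subst_gen W A \<and>\<^sub>f (subst_gen W B \<and>\<^sub>f F)) L
      = - (subst_gen W B \<and>\<^sub>f (subst_gen W A \<and>\<^sub>f F)) L" .
qed

text \<open>Multilinear expansion: choosing one generator from each factor is the same as choosing a function
\<open>p\<close> from the letters of the word to all indices. The word has to be distinct for this, as the choices are
indexed by its letters and not by its positions.\<close>

lemma wedge_word_subst_gen_expand:
  assumes "distinct w"
  shows "wedge_word (subst_gen W) w F =
    (\<lambda>L. \<Sum>p \<in> set w \<rightarrow>\<^sub>E UNIV. (\<Prod>C\<in>set w. W $ C $ p C) * wedge_word gen (map p w) F L)"
  using assms
proof (induction w)
  case (Cons C w)
  then have C: "C \<notin> set w"
    by simp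
  show ?case
  proof
    fix L
    have "(\<Sum>p \<in> set (C # w) \<rightarrow>\<^sub>E UNIV.
          (\<Prod>C\<in>set (C # w). W $ C $ p C) * wedge_word gen (map p (C # w)) F L)
        = (\<Sum>(A, p) \<in> UNIV \<times> (set w \<rightarrow>\<^sub>E UNIV). W $ C $ A * (\<Prod>C\<in>set w. W $ C $ p C)
            * (gen A \<and>\<^sub>f wedge_word gen (map p w) F) L)"
    proof -
      have upd: "map (p(C := A)) w = map p w" "(\<Prod>i\<in>set w. W $ i $ (p(C := A)) i) = (\<Prod>i\<in>set w. W $ i $ p i)"
        for p A
        using C by (auto intro!: prod.cong)
      show ?thesis
        unfolding list.set(2) PiE_insert_eq
        using C
        by (subst sum.reindex[OF inj_combinator[OF C]])
          (auto simp del: fun_upd_apply map_map simp add: upd case_prod_beta fun_upd_same intro!: sum.cong)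
    qed
    also have "\<dots> = wedge_word (subst_gen W) (C # w) F L"
    proof -
      have "wedge_word (subst_gen W) w F =
          (\<lambda>L. \<Sum>p \<in> set w \<rightarrow>\<^sub>E UNIV. (\<Prod>C\<in>set w. W $ C $ p C) * wedge_word gen (map p w) F L)"
        using Cons by simp
      then show ?thesis
        by (simp only: list.map foldr.simps o_apply subst_gen_wedge wedge_sum_right)
          (simp add: sum.cartesian_product[symmetric] sum_distrib_left mult_ac sum.swap[of _ UNIV])
    qed
    finally show "wedge_word (subst_gen W) (C # w) F L = (\<Sum>p \<in> set (C # w) \<rightarrow>\<^sub>E UNIV.
          (\<Prod>C\<in>set (C # w). W $ C $ p C) * wedge_word gen (map p (C # w)) F L)" ..
  qed
qed simp

text \<open>This is the Leibniz formula. A word with a repeated letter vanishes on both sides. Otherwise the word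
lists every index once; in its expansion the functions that are not injective give words with repeated
letters, and a permutation \<open>p\<close> reproduces the original word up to the sign of \<open>p\<close>.\<close>

lemma wedge_word_subst_gen:
  fixes W :: "complex ^ ('n::{finite,linorder} \<times> bool) ^ ('n \<times> bool)"
  assumes "length w = CARD('n \<times> bool)"
  shows "wedge_word (subst_gen W) w F = (\<lambda>L. det W * wedge_word gen w F L)"
proof (cases "distinct w")
  case False
  from wedge_word_not_distinct[OF subst_gen_anticommute this]
    wedge_word_not_distinct[OF gen_anticommute this]
  show ?thesis
    by simp
next
  case True
  then have UN: "set w = UNIV"
    using assms by (intro card_subset_eq) (simp_all only: distinct_card finite subset_UNIV)
  show ?thesis
  proof
    fix L
    have "wedge_word (subst_gen W) w F L
      = (\<Sum>p\<in>UNIV. (\<Prod>C\<in>UNIV. W $ C $ p C) * wedge_word gen (map p w) F L)"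
      unfolding wedge_word_subst_gen_expand[OF True] UN by (simp add: PiE_UNIV_domain)
    also have "\<dots> = (\<Sum>p | p permutes UNIV. (\<Prod>C\<in>UNIV. W $ C $ p C) * wedge_word gen (map p w) F L)"
    proof (rule sum.mono_neutral_right)
      show "\<forall>p \<in> UNIV - {p. p permutes UNIV}.
          (\<Prod>C\<in>UNIV. W $ C $ p C) * wedge_word gen (map p w) F L = 0"
      proof
        fix p :: "'n \<times> bool \<Rightarrow> 'n \<times> bool"
        \<comment> \<open>on a finite type a function that is no permutation is not injective\<close>
        assume "p \<in> UNIV - {p. p permutes UNIV}"
        then have "\<not> inj p"
          using finite_UNIV_inj_surj[of p] bij_imp_permutes[of p UNIV] by (auto simp: bij_def)
        then have "\<not> distinct (map p w)"
          using UN by (simp add: distinct_map)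
        from wedge_word_not_distinct[OF gen_anticommute this]
        show "(\<Prod>C\<in>UNIV. W $ C $ p C) * wedge_word gen (map p w) F L = 0"
          by simp
      qed
    qed simp_all
    also have "\<dots> = (\<Sum>p | p permutes UNIV.
        of_int (sign p) * (\<Prod>C\<in>UNIV. W $ C $ p C) * wedge_word gen w F L)"
      using wedge_word_permute[OF gen_anticommute True UN] by (intro sum.cong) auto
    also have "\<dots> = det W * wedge_word gen w F L"
      unfolding det_def by (simp add: sum_distrib_right)
    finally show "wedge_word (subst_gen W) w F L = det W * wedge_word gen w F L" .
  qed
qed

definition two_form ::
    "('n::{finite,linorder} \<times> bool \<Rightarrow> 'n form) \<Rightarrow> ('n \<times> bool \<Rightarrow> 'n \<times> bool \<Rightarrow> complex) \<Rightarrow> 'n form" where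
  "two_form \<theta> t = (\<lambda>L. \<Sum>A\<in>UNIV. \<Sum>B\<in>UNIV. t A B * (\<theta> A \<and>\<^sub>f \<theta> B) L)"

lemma two_form_scale: "two_form \<theta> (\<lambda>A B. c * t A B) = (\<lambda>L. c * two_form \<theta> t L)"
  by (simp add: two_form_def sum_distrib_left mult.assoc)

lemma two_form_wedge:
  "two_form \<theta> t \<and>\<^sub>f F = (\<lambda>L. \<Sum>A\<in>UNIV. \<Sum>B\<in>UNIV. t A B * ((\<theta> A \<and>\<^sub>f \<theta> B) \<and>\<^sub>f F) L)"
proof -
  have "two_form \<theta> t = (\<lambda>L. \<Sum>x\<in>UNIV. (case x of (A, B) \<Rightarrow> t A B) * (case x of (A, B) \<Rightarrow> \<theta> A \<and>\<^sub>f \<theta> B) L)"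
    unfolding two_form_def sum.cartesian_product UNIV_Times_UNIV by (simp add: case_prod_beta)
  then show ?thesis
    unfolding sum.cartesian_product UNIV_Times_UNIV by (simp add: wedge_sum_left case_prod_beta)
qed

lemma subst_gen_wedge_assoc: "(subst_gen W C \<and>\<^sub>f G) \<and>\<^sub>f F = subst_gen W C \<and>\<^sub>f (G \<and>\<^sub>f F)"
  unfolding subst_gen_wedge wedge_sum_left gen_wedge_assoc ..

lemma wedge_word_two_form:
  assumes "\<And>A G F. (\<theta> A \<and>\<^sub>f G) \<and>\<^sub>f F = \<theta> A \<and>\<^sub>f (G \<and>\<^sub>f F)"
  shows "wedge_word \<theta> w (two_form \<theta> t \<and>\<^sub>f F)
    = (\<lambda>L. \<Sum>A\<in>UNIV. \<Sum>B\<in>UNIV. t A B * wedge_word \<theta> (w @ [A, B]) F L)"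
proof -
  have "two_form \<theta> t \<and>\<^sub>f F
      = (\<lambda>L. \<Sum>x\<in>UNIV. (case x of (A, B) \<Rightarrow> t A B) * (case x of (A, B) \<Rightarrow> \<theta> A \<and>\<^sub>f (\<theta> B \<and>\<^sub>f F)) L)"
    unfolding two_form_wedge assms sum.cartesian_product UNIV_Times_UNIV by (simp add: case_prod_beta)
  then show ?thesis
    unfolding sum.cartesian_product UNIV_Times_UNIV by (simp add: wedge_word_sum case_prod_beta)
qed

text \<open>Multiplying the powers out turns them into combinations, with the same coefficients \<open>t\<close> on both sides, of
words of length \<open>CARD('n \<times> bool)\<close> applied to \<open>1\<close>. The prefix \<open>w\<close> collects the letters that are already
multiplied out, and makes the induction on \<open>k\<close> possible.\<close>

lemma wedge_power_subst_gen_aux: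
  fixes W :: "complex ^ ('n::{finite,linorder} \<times> bool) ^ ('n \<times> bool)"
  assumes "length w + 2 * k = CARD('n \<times> bool)"
  shows "wedge_word (subst_gen W) w (wedge_power (two_form (subst_gen W) t) k)
    = (\<lambda>L. det W * wedge_word gen w (wedge_power (two_form gen t) k) L)"
  using assms
proof (induction k arbitrary: w)
  case 0
  then show ?case
    by (simp add: wedge_power_def wedge_word_subst_gen)
next
  case (Suc k)
  have "wedge_word (subst_gen W) (w @ [A, B]) (wedge_power (two_form (subst_gen W) t) k)
    = (\<lambda>L. det W * wedge_word gen (w @ [A, B]) (wedge_power (two_form gen t) k) L)" for A B
    by (rule Suc.IH) (use Suc.prems in simp)
  note IH = this[folded append.simps]
  have S: "wedge_power F (Suc k) = F \<and>\<^sub>f wedge_power F k" for F :: "'n form"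
    by (simp add: wedge_power_def)
  show ?case
    unfolding S wedge_word_two_form[OF subst_gen_wedge_assoc] wedge_word_two_form[OF gen_wedge_assoc] IH
    by (simp add: sum_distrib_left mult_ac)
qed

lemma wedge_power_subst_gen:
  fixes W :: "complex ^ ('n::{finite,linorder} \<times> bool) ^ ('n \<times> bool)"
  shows "wedge_power (two_form (subst_gen W) t) CARD('n)
    = (\<lambda>L. det W * wedge_power (two_form gen t) CARD('n) L)"
  using wedge_power_subst_gen_aux[of "[]" "CARD('n)" W t] by simp

lemma wedge_power_scale: "wedge_power (\<lambda>L. c * F L) k = (\<lambda>L. c ^ k * wedge_power F k L)"
  by (induction k) (simp_all add: wedge_power_def wedge_scale_left wedge_scale_right mult_ac)

lemma gen_wedge_one: "gen B \<and>\<^sub>f form_const 1 = gen B"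
  unfolding gen_wedge form_const_def by (rule ext) (auto simp: gen_def shuffle_sign_def)

lemma gen_wedge_gen:
  fixes A B :: "'n::{finite,linorder} \<times> bool"
  shows "gen A \<and>\<^sub>f gen B = (\<lambda>L. - (gen B \<and>\<^sub>f gen A) L)"
  using gen_anticommute[of A B "form_const 1"] by (simp add: gen_wedge_one)

text \<open>Symmetric coefficients are killed by \<open>\<omega>\<^sup>A \<and> \<omega>\<^sup>B = - \<omega>\<^sup>B \<and> \<omega>\<^sup>A\<close>. This is what
removes all lower-order terms of the change of variables.\<close>

lemma two_form_gen_symmetric:
  assumes "\<And>A B. \<sigma> A B = \<sigma> B A"
  shows "two_form gen (\<lambda>A B. t A B + \<sigma> A B) = two_form gen t"
proof
  fix L
  let ?S = "\<Sum>A\<in>UNIV. \<Sum>B\<in>UNIV. \<sigma> A B * (gen A \<and>\<^sub>f gen B) L"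
  have "?S = (\<Sum>A\<in>UNIV. \<Sum>B\<in>UNIV. - (\<sigma> B A * (gen B \<and>\<^sub>f gen A) L))"
    by (subst gen_wedge_gen) (simp add: assms)
  also have "\<dots> = - ?S"
    by (subst sum.swap) (simp add: sum_negf)
  finally have "?S = 0"
    by simp
  then show "two_form gen (\<lambda>A B. t A B + \<sigma> A B) L = two_form gen t L"
    by (simp add: two_form_def distrib_right sum.distrib)
qed

lemma two_form_subst_gen:
  "two_form (subst_gen W) t = two_form gen (\<lambda>A B. \<Sum>C\<in>UNIV. \<Sum>D\<in>UNIV. W $ C $ A * W $ D $ B * t C D)"
proof
  fix L
  have "two_form (subst_gen W) t L = (\<Sum>C\<in>UNIV. \<Sum>D\<in>UNIV. \<Sum>A\<in>UNIV. \<Sum>B\<in>UNIV.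
      W $ C $ A * W $ D $ B * t C D * (gen A \<and>\<^sub>f gen B) L)"
    unfolding two_form_def subst_gen_wedge unfolding subst_gen_def wedge_sum_right
    by (simp only: sum_distrib_left mult.assoc mult.left_commute mult.commute)
  also have "\<dots> = (\<Sum>A\<in>UNIV. \<Sum>B\<in>UNIV. \<Sum>C\<in>UNIV. \<Sum>D\<in>UNIV.
      W $ C $ A * W $ D $ B * t C D * (gen A \<and>\<^sub>f gen B) L)"
    by (subst (2) sum.swap, subst (1) sum.swap, subst (3) sum.swap, subst (2) sum.swap) simp
  finally show "two_form (subst_gen W) t L
    = two_form gen (\<lambda>A B. \<Sum>C\<in>UNIV. \<Sum>D\<in>UNIV. W $ C $ A * W $ D $ B * t C D) L"
    by (simp add: two_form_def sum_distrib_right)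
qed

section \<open>Determinants of quaternionic matrices\<close>

lemma quat_emb_zero: "quat_emb 0 r c = 0"
  by (cases r; cases c) (simp_all add: quat_emb_def complex_eq_iff)

lemma quat_emb_one: "quat_emb 1 r c = (if r = c then 1 else 0)"
  by (cases r; cases c) (simp_all add: quat_emb_def one_quat_def complex_eq_iff)

lemma cmat_mult: "cmat (A ** B) = cmat A ** cmat B"
proof -
  have add: "quat_emb (x + y) r c = quat_emb x r c + quat_emb y r c" for x y r c
    by (cases r; cases c) (simp_all add: quat_emb_def complex_eq_iff)
  have sum: "quat_emb (sum f S) r c = (\<Sum>k\<in>S. quat_emb (f k) r c)" for f and S :: "'k set" and r c
    by (induction S rule: infinite_finite_induct) (simp_all add: quat_emb_zero add)
  show ?thesis
    unfolding cmat_def matrix_matrix_mult_def vec_eq_iff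
    by (simp add: sum quat_emb_mult sum.cartesian_product split_beta flip: UNIV_Times_UNIV)
qed

lemma cmat_one: "cmat (mat 1) = mat 1"
  by (auto simp: cmat_def mat_def vec_eq_iff prod_eq_iff quat_emb_one quat_emb_zero)

lemma cmat_inject: "cmat A = cmat B \<longleftrightarrow> A = B"
proof
  assume eq: "cmat A = cmat B"
  have "A $ i $ j = B $ i $ j" for i j
  proof -
    have "quat_emb (A $ i $ j) r c = quat_emb (B $ i $ j) r c" for r c
      using arg_cong[OF eq, of "\<lambda>N. N $ (i, r) $ (j, c)"] by (simp add: cmat_def)
    from this[of False False] this[of True False] show ?thesis
      by (simp add: quat_emb_def quat_eq_iff)
  qed
  then show "A = B"
    by (simp add: vec_eq_iff)
qed simp

text \<open>This is \<open>J N\<^sup>* J\<^sup>-\<^sup>1\<close> with the entrywise conjugate \<open>N\<^sup>*\<close> of \<open>N\<close> and the block-diagonal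
matrix \<open>J\<close> with the blocks \<open>(0 -1 / 1 0)\<close>, a slash separating the rows. It is a
multiplicative involution, and its fixed points are the matrices that come from quaternionic ones; hence the inverse of such a matrix is again of this kind.\<close>

definition quat_conj_mat :: "complex ^ ('k \<times> bool) ^ ('k::finite \<times> bool) \<Rightarrow> complex ^ ('k \<times> bool) ^ ('k \<times> bool)"
  where "quat_conj_mat N = (\<chi> r c. (if snd r = snd c then 1 else -1)
    * cnj (N $ (fst r, \<not> snd r) $ (fst c, \<not> snd c)))"

lemma quat_conj_mat_mult: "quat_conj_mat (N ** P) = quat_conj_mat N ** quat_conj_mat P"
proof -
  have s: "(\<Sum>m\<in>UNIV. f m) = (\<Sum>m\<in>UNIV. f (fst m, \<not> snd m))" for f :: "'k \<times> bool \<Rightarrow> complex"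
    by (rule sum.reindex_bij_witness[of _ "\<lambda>m. (fst m, \<not> snd m)" "\<lambda>m. (fst m, \<not> snd m)"]) auto
  have "(if snd r = snd c then 1 else -1) * (\<Sum>m\<in>UNIV. cnj (N $ (fst r, \<not> snd r) $ m) * cnj (P $ m $ (fst c, \<not> snd c)))
    = (\<Sum>m\<in>UNIV. (if snd r = snd m then 1 else - 1) * cnj (N $ (fst r, \<not> snd r) $ (fst m, \<not> snd m)) *
             ((if snd m = snd c then 1 else - 1) * cnj (P $ (fst m, \<not> snd m) $ (fst c, \<not> snd c))))"
    for r c
    unfolding sum_distrib_left
  proof (subst s, rule sum.cong)
    fix m :: "'a \<times> bool"
    show "(if snd r = snd c then 1 else -1) * (cnj (N $ (fst r, \<not> snd r) $ (fst m, \<not> snd m))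
          * cnj (P $ (fst m, \<not> snd m) $ (fst c, \<not> snd c)))
        = (if snd r = snd m then 1 else - 1) * cnj (N $ (fst r, \<not> snd r) $ (fst m, \<not> snd m)) *
             ((if snd m = snd c then 1 else - 1) * cnj (P $ (fst m, \<not> snd m) $ (fst c, \<not> snd c)))"
      by (cases "snd r"; cases "snd c"; cases "snd m") simp_all
  qed simp
  then show ?thesis
    by (simp add: quat_conj_mat_def matrix_matrix_mult_def vec_eq_iff)
qed

lemma quat_conj_mat_cmat: "quat_conj_mat (cmat A) = cmat A"
proof -
  have "(if r = c then 1 else -1) * cnj (quat_emb q (\<not> r) (\<not> c)) = quat_emb q r c" for q r c
    by (cases r; cases c) (simp_all add: quat_emb_def complex_eq_iff)
  then show ?thesis
    by (simp add: quat_conj_mat_def cmat_def vec_eq_iff)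
qed

lemma quat_conj_mat_fixed_imp_cmat:
  assumes "quat_conj_mat N = N"
  obtains A where "N = cmat A"
proof
  let ?A = "\<chi> i j. Quat (Re (N $ (i, False) $ (j, False))) (Im (N $ (i, False) $ (j, False)))
    (Re (N $ (i, True) $ (j, False))) (- Im (N $ (i, True) $ (j, False)))"
  have "N $ (i, r) $ (j, c) = cmat ?A $ (i, r) $ (j, c)" for i r j c
    using arg_cong[OF assms, of "\<lambda>N. N $ (i, r) $ (j, c)"]
    by (cases r; cases c) (auto simp: quat_conj_mat_def cmat_def quat_emb_def complex_eq_iff)
  then show "N = cmat ?A"
    unfolding vec_eq_iff split_paired_All by blast
qed

text \<open>The point is that \<open>g\<close> is invertible as a quaternionic matrix, so that \<^const>\<open>matrix_inv\<close> has its
intended meaning. The complex inverse of \<open>cmat g\<close> is fixed by \<^const>\<open>quat_conj_mat\<close>, as inverses are unique,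
and therefore comes from a quaternionic inverse of \<open>g\<close>.\<close>

lemma det_cmat_matrix_inv:
  assumes "det (cmat g) = 1"
  shows "det (cmat (matrix_inv g)) = 1"
proof -
  let ?N = "cmat g"
  obtain P where P: "?N ** P = mat 1" "P ** ?N = mat 1"
    using assms invertible_det_nz[of ?N] unfolding invertible_def by auto
  have "quat_conj_mat P ** ?N = mat 1"
    using quat_conj_mat_mult[of P ?N] quat_conj_mat_cmat[of "mat 1 :: quat ^ 'a ^ 'a"]
    by (simp add: quat_conj_mat_cmat P cmat_one)
  then have "quat_conj_mat P = P"
    by (metis P(1) matrix_mul_assoc matrix_mul_lid matrix_mul_rid)
  then obtain h where "P = cmat h"
    by (rule quat_conj_mat_fixed_imp_cmat)
  then have "g ** h = mat 1" "h ** g = mat 1"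
    using P by (simp_all add: cmat_inject flip: cmat_mult cmat_one)
  then have "g ** matrix_inv g = mat 1"
    unfolding matrix_inv_def by (metis (mono_tags, lifting) someI_ex)
  then have "det ?N * det (cmat (matrix_inv g)) = 1"
    by (simp add: cmat_one flip: det_mul cmat_mult)
  with assms show ?thesis
    by simp
qed

text \<open>A matrix whose rows outside a set of indices are rows of the identity has the determinant of its
principal block on that set: in the Leibniz formula only the permutations that fix all other indices
survive. The block is given by an embedding \<open>\<iota>\<close> of its index type, because the size of a matrix is a type.\<close>

lemma det_principal_block:
  fixes M :: "'a::comm_ring_1 ^ 'n::finite ^ 'n" and \<iota> :: "'m::finite \<Rightarrow> 'n"
  assumes "inj \<iota>" and id: "\<And>i j. i \<notin> range \<iota> \<Longrightarrow> M $ i $ j = (if i = j then 1 else 0)"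
  shows "det M = det (\<chi> i j. M $ \<iota> i $ \<iota> j)"
proof -
  have "det M = (\<Sum>p | p permutes range \<iota>. of_int (sign p) * (\<Prod>i\<in>UNIV. M $ i $ p i))"
    unfolding det_def
  proof (rule sum.mono_neutral_right)
    show "\<forall>p\<in>{p. p permutes UNIV} - {p. p permutes range \<iota>}. of_int (sign p) * (\<Prod>i\<in>UNIV. M $ i $ p i) = 0"
    proof
      fix p assume p: "p \<in> {p. p permutes UNIV} - {p. p permutes range \<iota>}"
      then obtain i where "i \<notin> range \<iota>" "p i \<noteq> i"
        by (auto simp: permutes_def)
      then have "M $ i $ p i = 0"
        using id by simp
      then have "(\<Prod>i\<in>UNIV. M $ i $ p i) = 0"
        by (metis UNIV_I finite prod_zero)
      then show "of_int (sign p) * (\<Prod>i\<in>UNIV. M $ i $ p i) = 0"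
        by simp
    qed
  qed (auto intro: permutes_subset[OF _ subset_UNIV])
  also have "\<dots> = (\<Sum>p | p permutes range \<iota>. of_int (sign p) * (\<Prod>i\<in>range \<iota>. M $ i $ p i))"
  proof (rule sum.cong)
    fix p assume "p \<in> {p. p permutes range \<iota>}"
    then have "(\<Prod>i\<in>UNIV. M $ i $ p i) = (\<Prod>i\<in>range \<iota>. M $ i $ p i)"
      by (intro prod.mono_neutral_right) (auto simp: id permutes_not_in)
    then show "of_int (sign p) * (\<Prod>i\<in>UNIV. M $ i $ p i) = of_int (sign p) * (\<Prod>i\<in>range \<iota>. M $ i $ p i)"
      by simp
  qed simp
  also have "\<dots> = (\<Sum>p | p permutes (UNIV :: 'm set). of_int (sign (map_permutation UNIV \<iota> p)) *
      (\<Prod>i\<in>range \<iota>. M $ i $ map_permutation UNIV \<iota> p i))"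
  proof (rule sum.reindex_bij_betw[symmetric])
    have "bij_betw \<iota> UNIV (range \<iota>)"
      using assms(1) by (rule inj_on_imp_bij_betw)
    from bij_betw_permutations[OF this]
    show "bij_betw (map_permutation UNIV \<iota>) {p. p permutes UNIV} {p. p permutes range \<iota>}"
      by (simp add: map_permutation_def[abs_def] restrict_id_def[abs_def] o_def)
  qed
  also have "\<dots> = det (\<chi> i j. M $ \<iota> i $ \<iota> j)"
    unfolding det_def
    by (rule sum.cong) (simp_all add: sign_map_permutation assms(1) prod.reindex map_permutation_apply)
  finally show ?thesis .
qed

definition block_mat :: "quat \<Rightarrow> quat ^ 'n \<Rightarrow> quat ^ 'n \<Rightarrow> quat ^ 'n ^ 'n \<Rightarrow> quat ^ 'n::finite option ^ 'n option" where
  "block_mat a b c d = (\<chi> i j. case i of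
      None \<Rightarrow> (case j of None \<Rightarrow> a | Some j \<Rightarrow> b $ j)
    | Some i \<Rightarrow> (case j of None \<Rightarrow> c $ i | Some j \<Rightarrow> d $ i $ j))"

lemma det_cmat_block_lower: "det (cmat (block_mat 1 0 c W)) = det (cmat W)"
proof -
  let ?\<iota> = "\<lambda>(i, r). (Some i, r)"
  have "det (cmat (block_mat 1 0 c W)) = det (\<chi> i j. cmat (block_mat 1 0 c W) $ ?\<iota> i $ ?\<iota> j)"
  proof (rule det_principal_block)
    fix i j :: "'a option \<times> bool"
    assume "i \<notin> range ?\<iota>"
    then have "fst i = None"
      by (cases i; cases "fst i") (auto simp: image_iff)
    then show "cmat (block_mat 1 0 c W) $ i $ j = (if i = j then 1 else 0)"
      by (cases i; cases j) (auto simp: cmat_def block_mat_def quat_emb_one quat_emb_zero split: option.splits)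
  qed (auto intro: injI)
  also have "(\<chi> i j. cmat (block_mat 1 0 c W) $ ?\<iota> i $ ?\<iota> j) = cmat W"
    by (simp add: vec_eq_iff cmat_def block_mat_def split_beta)
  finally show ?thesis .
qed

lemma det_bool: "det (A :: 'a::comm_ring_1 ^ bool ^ bool)
    = A $ False $ False * A $ True $ True - A $ False $ True * A $ True $ False"
proof -
  have f: "finite {True}" "False \<notin> {True}"
    by auto
  show ?thesis
    unfolding det_def UNIV_bool sum_over_permutations_insert[OF f]
    unfolding permutes_sing
    by (simp add: sign_swap_id sign_id swap_id_eq)
qed

lemma quat_emb_det: "quat_emb q False False * quat_emb q True True
    - quat_emb q False True * quat_emb q True False = complex_of_real ((norm q)\<^sup>2)"
  by (simp add: quat_emb_def complex_eq_iff power2_norm_eq_inner inner_quat_def)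

lemma det_cmat_block_upper: "det (cmat (block_mat s b 0 (mat 1))) = complex_of_real ((norm s)\<^sup>2)"
proof -
  let ?\<iota> = "\<lambda>r::bool. (None, r)"
  have "det (cmat (block_mat s b 0 (mat 1)))
    = det (\<chi> i j. cmat (block_mat s b 0 (mat 1)) $ ?\<iota> i $ ?\<iota> j)"
  proof (rule det_principal_block)
    fix i j :: "'a option \<times> bool"
    assume "i \<notin> range ?\<iota>"
    then have "fst i \<noteq> None"
      by (cases i) (auto simp: image_iff)
    then show "cmat (block_mat s b 0 (mat 1)) $ i $ j = (if i = j then 1 else 0)"
      by (cases i; cases j) (auto simp: cmat_def block_mat_def mat_def quat_emb_one quat_emb_zero split: option.splits)
  qed (auto intro: injI)
  then show ?thesis
    by (simp add: det_bool cmat_def block_mat_def quat_emb_det)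
qed

text \<open>The matrix \<open>d - p b\<close> with \<open>p = h.q\<close>: the left factor in the differential of the action of \<open>h\<close> at \<open>q\<close>, and
the Schur complement in the block elimination of \<open>h\<close>.\<close>

definition pact_factor ::
    "quat ^ 'n::finite option ^ 'n option \<Rightarrow> quat ^ 'n \<Rightarrow> quat ^ 'n ^ 'n" where
  "pact_factor h q = (\<chi> i j. blk_d h $ i $ j - pact h q $ i * blk_b h $ j)"

text \<open>With \<open>s = a + b q\<close>, \<open>p = h.q\<close> and \<open>W = d - p b\<close>, so that \<open>p s = c + d q\<close>, block elimination reads
\<open>h (1 0 / q 1) = (1 0 / p W) (s b / 0 1)\<close>, where a slash separates the block rows. The four
determinants are evaluated by the preceding lemmas.\<close>

lemma det_pact_factor:
  assumes "pdenom h q \<noteq> 0"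
  shows "complex_of_real ((norm (pdenom h q))\<^sup>2) * det (cmat (pact_factor h q)) = det (cmat h)"
proof -
  let ?s = "pdenom h q" and ?p = "pact h q" and ?W = "pact_factor h q"
  have UN: "(\<Sum>k\<in>UNIV. f k) = f None + (\<Sum>k\<in>UNIV. f (Some k))" for f :: "'a option \<Rightarrow> quat"
    unfolding UNIV_option_conv by (simp add: sum.reindex)
  have ps: "?p $ i * ?s = (blk_c h + blk_d h *v q) $ i" for i
    using assms by (simp add: pact_def mult.assoc)
  have "h ** block_mat 1 0 q (mat 1) = block_mat 1 0 ?p ?W ** block_mat ?s (blk_b h) 0 (mat 1)"
  proof -
    have d1: "(\<Sum>k\<in>UNIV. f k * mat 1 $ k $ j) = f j" for f :: "'a \<Rightarrow> quat" and j
      unfolding mat_def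
      by (simp only: vec_lambda_beta if_distrib if_distribR sum.delta[OF finite] mult_1_right mult_zero_right if_True UNIV_I)
    have "(h ** block_mat 1 0 q (mat 1)) $ i $ j
       = (block_mat 1 0 ?p ?W ** block_mat ?s (blk_b h) 0 (mat 1)) $ i $ j" for i j
    proof (cases i)
      case None
      then show ?thesis
        by (cases j) (simp_all add: matrix_matrix_mult_def UN block_mat_def d1 pdenom_def
            blk_a_def blk_b_def)
    next
      case (Some k)
      show ?thesis
      proof (cases j)
        case None
        have "(h ** block_mat 1 0 q (mat 1)) $ i $ j = (blk_c h + blk_d h *v q) $ k"
          unfolding Some None matrix_matrix_mult_def block_mat_def
          by (simp add: UN blk_c_def blk_d_def matrix_vector_mult_def)
        also have "\<dots> = ?p $ k * ?s"
          by (rule ps[symmetric])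
        also have "\<dots> = (block_mat 1 0 ?p ?W ** block_mat ?s (blk_b h) 0 (mat 1)) $ i $ j"
          unfolding Some None matrix_matrix_mult_def block_mat_def
          by (simp add: UN)
        finally show ?thesis .
      next
        case (Some l)
        then show ?thesis
          unfolding Some \<open>i = Some k\<close> matrix_matrix_mult_def block_mat_def
          by (simp add: UN d1 pact_factor_def blk_b_def blk_d_def)
      qed
    qed
    then show ?thesis
      by (simp add: vec_eq_iff)
  qed
  from arg_cong[OF this, of "\<lambda>A. det (cmat A)"] show ?thesis
    by (simp add: cmat_mult det_mul det_cmat_block_lower det_cmat_block_upper cmat_one mult_ac)
qed

section \<open>Second derivatives\<close>

lemma linear_axis: "linear (axis i :: 'a::real_vector \<Rightarrow> 'a ^ 'n)"
  by (auto simp: linear_iff vec_eq_iff axis_def)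

lemma has_derivative_vecI:
  fixes f :: "'a::real_normed_vector \<Rightarrow> 'b::euclidean_space ^ 'n::finite"
  assumes "\<And>i. ((\<lambda>x. f x $ i) has_derivative (\<lambda>h. f' h $ i)) F"
  shows "(f has_derivative f') F"
proof -
  have e: "v = (\<Sum>i\<in>UNIV. axis i (v $ i))" for v :: "'b ^ 'n"
    by (simp add: vec_eq_iff axis_def)
  have bl: "bounded_linear (axis i :: 'b \<Rightarrow> 'b ^ 'n)" for i
    unfolding linear_conv_bounded_linear[symmetric] by (rule linear_axis)
  have "((\<lambda>x. \<Sum>i\<in>UNIV. axis i (f x $ i)) has_derivative (\<lambda>h. \<Sum>i\<in>UNIV. axis i (f' h $ i))) F"
    by (intro has_derivative_sum bounded_linear.has_derivative[OF bl] assms)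
  then show ?thesis
    unfolding e[symmetric] .
qed

definition second_deriv :: "('a::real_normed_vector \<Rightarrow> 'b::real_normed_vector) \<Rightarrow> 'a \<Rightarrow> 'a \<Rightarrow> 'a \<Rightarrow> 'b" where
  "second_deriv f x X Y = frechet_derivative (\<lambda>y. frechet_derivative f (at y) Y) (at x) X"

lemma C2_derivatives:
  assumes "Ck_on (Suc (Suc 0)) T f" "x \<in> T"
  shows "(f has_derivative frechet_derivative f (at x)) (at x)"
    and "((\<lambda>y. frechet_derivative f (at y) Y) has_derivative (\<lambda>X. second_deriv f x X Y)) (at x)"
    and "continuous_on T (\<lambda>x. second_deriv f x X Y)"
proof -
  show "(f has_derivative frechet_derivative f (at x)) (at x)"
    using assms by (simp add: frechet_derivative_works[symmetric])
  have "(\<lambda>y. frechet_derivative f (at y) Y) differentiable (at x)"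
    using assms by simp
  then show "((\<lambda>y. frechet_derivative f (at y) Y) has_derivative (\<lambda>X. second_deriv f x X Y)) (at x)"
    unfolding second_deriv_def frechet_derivative_works by simp
  show "continuous_on T (\<lambda>x. second_deriv f x X Y)"
    using assms unfolding second_deriv_def by simp
qed

lemma has_real_derivative_along_line:
  fixes f :: "'a::real_normed_vector \<Rightarrow> real"
  assumes "(f has_derivative D) (at (a + s *\<^sub>R X))"
  shows "((\<lambda>s. f (a + s *\<^sub>R X)) has_real_derivative D X) (at s)"
proof -
  have "((\<lambda>s. a + s *\<^sub>R X) has_derivative (\<lambda>r. r *\<^sub>R X)) (at s)"
    by (auto intro!: derivative_eq_intros)
  from has_derivative_compose[OF this assms]
  have "((\<lambda>s. f (a + s *\<^sub>R X)) has_derivative (\<lambda>r. D (r *\<^sub>R X))) (at s)" .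
  moreover have "D (r *\<^sub>R X) = D X * r" for r
    using linear_cmul[OF has_derivative_linear[OF assms]] by simp
  ultimately show ?thesis
    unfolding has_field_derivative_def by simp
qed

text \<open>The mean value theorem, first in the direction \<open>X\<close> and then in the direction \<open>Y\<close>. The left-hand side of
the identity is symmetric in \<open>X\<close> and \<open>Y\<close>, which forces the symmetry of the second derivative in the limit
\<open>h \<rightarrow> 0\<close>.\<close>

lemma second_difference:
  fixes f :: "'a::real_normed_vector \<Rightarrow> real"
  assumes C2: "Ck_on (Suc (Suc 0)) T f" and "h > 0"
    and T: "\<And>s t. \<lbrakk>0 \<le> s; s \<le> h; 0 \<le> t; t \<le> h\<rbrakk> \<Longrightarrow> x + s *\<^sub>R X + t *\<^sub>R Y \<in> T"
  obtains s t where "0 \<le> s" "s \<le> h" "0 \<le> t" "t \<le> h"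
    "f (x + h *\<^sub>R X + h *\<^sub>R Y) - f (x + h *\<^sub>R X) - f (x + h *\<^sub>R Y) + f x
      = h * h * second_deriv f (x + s *\<^sub>R X + t *\<^sub>R Y) Y X"
proof -
  let ?D = "\<lambda>y. frechet_derivative f (at y)"
  let ?F = "\<lambda>s. f (x + s *\<^sub>R X + h *\<^sub>R Y) - f (x + s *\<^sub>R X)"
  have "(?F has_real_derivative (?D (x + s *\<^sub>R X + h *\<^sub>R Y) X - ?D (x + s *\<^sub>R X) X)) (at s)"
    if s: "0 \<le> s" "s \<le> h" for s
  proof -
    have in_T: "x + s *\<^sub>R X + h *\<^sub>R Y \<in> T" "x + s *\<^sub>R X \<in> T"
      using T[of s h] T[of s 0] s \<open>h > 0\<close> by auto
    have "((\<lambda>s. f (x + h *\<^sub>R Y + s *\<^sub>R X)) has_real_derivative ?D (x + h *\<^sub>R Y + s *\<^sub>R X) X) (at s)"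
      using C2_derivatives(1)[OF C2 in_T(1)]
      by (intro has_real_derivative_along_line) (simp add: add_ac)
    moreover have "((\<lambda>s. f (x + s *\<^sub>R X)) has_real_derivative ?D (x + s *\<^sub>R X) X) (at s)"
      using C2_derivatives(1)[OF C2 in_T(2)] by (rule has_real_derivative_along_line)
    ultimately show ?thesis
      by (auto intro!: DERIV_diff simp: add_ac)
  qed
  from MVT2[OF \<open>h > 0\<close>, of ?F, OF this] obtain s where s: "0 < s" "s < h"
    "?F h - ?F 0 = h * (?D (x + s *\<^sub>R X + h *\<^sub>R Y) X - ?D (x + s *\<^sub>R X) X)"
    by auto
  let ?G = "\<lambda>t. ?D (x + s *\<^sub>R X + t *\<^sub>R Y) X"
  have "(?G has_real_derivative second_deriv f (x + s *\<^sub>R X + t *\<^sub>R Y) Y X) (at t)"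
    if t: "0 \<le> t" "t \<le> h" for t
  proof -
    have "x + s *\<^sub>R X + t *\<^sub>R Y \<in> T"
      using T[of s t] s t by auto
    from C2_derivatives(2)[OF C2 this, of X] show ?thesis
      by (rule has_real_derivative_along_line)
  qed
  from MVT2[OF \<open>h > 0\<close>, of ?G, OF this] obtain t where t: "0 < t" "t < h"
    "?G h - ?G 0 = h * second_deriv f (x + s *\<^sub>R X + t *\<^sub>R Y) Y X"
    by auto
  show ?thesis
    using s t by (intro that[of s t]) auto
qed

text \<open>Schwarz' theorem. Second differences of step \<open>h n \<rightarrow> 0\<close>, computed in both orders, give points
\<open>a n\<close> and \<open>b n\<close> converging to \<open>x\<close> at which the two mixed derivatives agree; continuity does the rest.\<close>

lemma second_deriv_symmetric:
  fixes f :: "'a::real_normed_vector \<Rightarrow> real"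
  assumes C2: "Ck_on (Suc (Suc 0)) T f" and "open T" "x \<in> T"
  shows "second_deriv f x X Y = second_deriv f x Y X"
proof -
  obtain e where e: "e > 0" "ball x e \<subseteq> T"
    using assms(2,3) open_contains_ball by blast
  define N where "N = norm X + norm Y + 1"
  \<comment> \<open>small enough that all points of the second difference stay in the ball of radius \<open>e\<close> about \<open>x\<close>\<close>
  define h where "h n = e / 2 / N * inverse (real (Suc n))" for n
  have N: "N > 0"
    unfolding N_def by (metis add_nonneg_pos add_nonneg_nonneg norm_ge_zero zero_less_one)
  have h: "h n > 0" for n
    using e N by (simp add: h_def)
  have h0: "h \<longlonglongrightarrow> 0"
    unfolding h_def by (rule tendsto_mult_right_zero[OF LIMSEQ_inverse_real_of_nat])
  have dist: "dist (x + s *\<^sub>R X + t *\<^sub>R Y) x \<le> h n * N"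
    if "0 \<le> s" "s \<le> h n" "0 \<le> t" "t \<le> h n" for s t n
  proof -
    have "dist (x + s *\<^sub>R X + t *\<^sub>R Y) x = norm (s *\<^sub>R X + t *\<^sub>R Y)"
      by (simp add: dist_norm algebra_simps)
    also have "\<dots> \<le> s * norm X + t * norm Y"
      using norm_triangle_ineq[of "s *\<^sub>R X" "t *\<^sub>R Y"] that by simp
    also have "\<dots> \<le> h n * norm X + h n * norm Y"
      using that by (intro add_mono mult_right_mono) auto
    also have "\<dots> \<le> h n * N"
      using h[of n] by (simp add: N_def algebra_simps)
    finally show ?thesis .
  qed
  have small: "h n * N < e" for n
  proof -
    have "h n * N = e / 2 * inverse (real (Suc n))"
      using N by (simp add: h_def)
    also have "\<dots> \<le> e / 2 * 1"
      using e by (intro mult_left_mono) (auto simp: divide_simps)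
    finally show ?thesis
      using e by simp
  qed
  have "\<exists>a b. dist a x \<le> h n * N \<and> dist b x \<le> h n * N \<and>
     second_deriv f a Y X = second_deriv f b X Y" for n
  proof -
    have T: "x + s *\<^sub>R X + t *\<^sub>R Y \<in> T"
      if "0 \<le> s" "s \<le> h n" "0 \<le> t" "t \<le> h n" for s t
      using dist[OF that] small[of n] e(2) by (auto simp: dist_commute)
    have T': "x + s *\<^sub>R Y + t *\<^sub>R X \<in> T"
      if "0 \<le> s" "s \<le> h n" "0 \<le> t" "t \<le> h n" for s t
      using T[OF that(3,4,1,2)] by (simp add: add_ac)
    obtain s t where st: "0 \<le> s" "s \<le> h n" "0 \<le> t" "t \<le> h n"
      "f (x + h n *\<^sub>R X + h n *\<^sub>R Y) - f (x + h n *\<^sub>R X) - f (x + h n *\<^sub>R Y) + f x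
        = h n * h n * second_deriv f (x + s *\<^sub>R X + t *\<^sub>R Y) Y X"
      by (rule second_difference[OF C2 h, of n x X Y, OF T])
    obtain t' s' where st': "0 \<le> t'" "t' \<le> h n" "0 \<le> s'" "s' \<le> h n"
      "f (x + h n *\<^sub>R Y + h n *\<^sub>R X) - f (x + h n *\<^sub>R Y) - f (x + h n *\<^sub>R X) + f x
        = h n * h n * second_deriv f (x + t' *\<^sub>R Y + s' *\<^sub>R X) X Y"
      by (rule second_difference[OF C2 h, of n x Y X, OF T'])
    have "h n * h n * second_deriv f (x + s *\<^sub>R X + t *\<^sub>R Y) Y X
        = h n * h n * second_deriv f (x + s' *\<^sub>R X + t' *\<^sub>R Y) X Y"
      using st(5) st'(5)
      unfolding add.assoc[of x "h n *\<^sub>R Y"] add.assoc[of x "t' *\<^sub>R Y"]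
        add.commute[of "h n *\<^sub>R Y"] add.commute[of "t' *\<^sub>R Y"]
      by (simp only: add.assoc[symmetric])
    then have "second_deriv f (x + s *\<^sub>R X + t *\<^sub>R Y) Y X
        = second_deriv f (x + s' *\<^sub>R X + t' *\<^sub>R Y) X Y"
      using h[of n] by simp
    with dist[OF st(1-4)] dist[OF st'(3,4,1,2)] show ?thesis
      by blast
  qed
  then obtain a b where a: "\<And>n. dist (a n) x \<le> h n * N" and b: "\<And>n. dist (b n) x \<le> h n * N"
    and eq: "\<And>n. second_deriv f (a n) Y X = second_deriv f (b n) X Y"
    by metis
  have lim: "(\<lambda>n. second_deriv f (c n) Z W) \<longlonglongrightarrow> second_deriv f x Z W"
    if c: "\<And>n. dist (c n) x \<le> h n * N" for c Z W
  proof -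
    have "(\<lambda>n. dist (c n) x) \<longlonglongrightarrow> 0"
      by (rule tendsto_sandwich[OF _ _ tendsto_const tendsto_mult_left_zero[OF h0, of N]]) (simp_all add: c)
    then have "c \<longlonglongrightarrow> x"
      by (rule tendsto_dist_iff[THEN iffD2])
    moreover have "isCont (\<lambda>x. second_deriv f x Z W) x"
      using C2_derivatives(3)[OF C2 \<open>x \<in> T\<close>] assms(2,3) continuous_on_eq_continuous_at by blast
    ultimately show ?thesis
      by (rule isCont_tendsto_compose[rotated])
  qed
  have "(\<lambda>n. second_deriv f (b n) X Y) \<longlonglongrightarrow> second_deriv f x Y X"
    using lim[OF a, of Y X] by (simp add: eq)
  from LIMSEQ_unique[OF lim[OF b] this] show ?thesis .
qed

lemma second_deriv_linear:
  fixes f :: "'a::real_normed_vector \<Rightarrow> real"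
  assumes C2: "Ck_on (Suc (Suc 0)) T f" and "open T" "x \<in> T"
  shows "linear (\<lambda>X. second_deriv f x X Y)" "linear (\<lambda>Y. second_deriv f x X Y)"
proof -
  show 1: "linear (\<lambda>X. second_deriv f x X Y)" for Y
    using C2_derivatives(2)[OF C2 \<open>x \<in> T\<close>] by (rule has_derivative_linear)
  show "linear (\<lambda>Y. second_deriv f x X Y)"
    using 1[of X] second_deriv_symmetric[OF assms] by simp
qed

lemma linear_real_expand:
  fixes f :: "'a::euclidean_space \<Rightarrow> real"
  assumes "linear f"
  shows "f w = (\<Sum>b\<in>Basis. (w \<bullet> b) * f b)"
proof -
  have "f w = f (\<Sum>b\<in>Basis. (w \<bullet> b) *\<^sub>R b)"
    by (simp add: euclidean_representation)
  then show ?thesis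
    by (simp add: linear_sum[OF assms] linear_cmul[OF assms])
qed

text \<open>Both the base point \<open>\<psi> x\<close> and the argument \<open>w x\<close> move. Expanding the argument in the standard basis
separates them and reduces the claim to the product rule.\<close>

lemma has_derivative_frechet_derivative_chain:
  fixes f :: "'b::euclidean_space \<Rightarrow> real" and \<psi> w :: "'a::real_normed_vector \<Rightarrow> 'b"
  assumes C2: "Ck_on (Suc (Suc 0)) T f" and "open T" and "open N" "q \<in> N" and N: "\<psi> ` N \<subseteq> T"
    and \<psi>: "(\<psi> has_derivative \<psi>') (at q)" and w: "(w has_derivative w') (at q)"
  shows "((\<lambda>x. frechet_derivative f (at (\<psi> x)) (w x)) has_derivative
    (\<lambda>X. second_deriv f (\<psi> q) (\<psi>' X) (w q) + frechet_derivative f (at (\<psi> q)) (w' X))) (at q)"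
proof -
  let ?D = "\<lambda>y. frechet_derivative f (at y)" and ?H = "second_deriv f (\<psi> q)"
  have T: "\<psi> x \<in> T" if "x \<in> N" for x
    using N that by auto
  have lin: "linear (?D (\<psi> x))" if "x \<in> N" for x
    using C2_derivatives(1)[OF C2 T[OF that]] by (rule has_derivative_linear)
  have "((\<lambda>x. ?D (\<psi> x) b) has_derivative (\<lambda>X. ?H (\<psi>' X) b)) (at q)" for b
    by (rule has_derivative_compose[OF \<psi> C2_derivatives(2)[OF C2 T[OF \<open>q \<in> N\<close>]]])
  then have "((\<lambda>x. \<Sum>b\<in>Basis. (w x \<bullet> b) * ?D (\<psi> x) b) has_derivative
      (\<lambda>X. \<Sum>b\<in>Basis. (w q \<bullet> b) * ?H (\<psi>' X) b + (w' X \<bullet> b) * ?D (\<psi> q) b)) (at q)"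
    by (intro has_derivative_sum has_derivative_mult has_derivative_inner_left w)
  moreover have "(\<Sum>b\<in>Basis. (w q \<bullet> b) * ?H (\<psi>' X) b + (w' X \<bullet> b) * ?D (\<psi> q) b)
      = ?H (\<psi>' X) (w q) + ?D (\<psi> q) (w' X)" for X
    using linear_real_expand[OF second_deriv_linear(2)[OF C2 \<open>open T\<close> T[OF \<open>q \<in> N\<close>]], of "\<psi>' X" "w q"]
      linear_real_expand[OF lin[OF \<open>q \<in> N\<close>], of "w' X"]
    by (simp add: sum.distrib)
  ultimately have "((\<lambda>x. \<Sum>b\<in>Basis. (w x \<bullet> b) * ?D (\<psi> x) b) has_derivative
      (\<lambda>X. ?H (\<psi>' X) (w q) + ?D (\<psi> q) (w' X))) (at q)"
    by simp
  then show ?thesis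
    by (rule has_derivative_transform_within_open[OF _ \<open>open N\<close> \<open>q \<in> N\<close>])
      (rule linear_real_expand[OF lin, symmetric])
qed

section \<open>The symbols of the operators nabla\<close>

text \<open>Each \<open>\<nabla>\<close> with indices \<open>A', A\<close> is the derivative along a complexified vector. The symbol of the operator
evaluates a real-linear functional at this vector, by complex linearity: \<open>symbol1\<close> within one
quaternionic coordinate, \<open>symbol\<close> on \<open>H\<^sup>n\<close>.\<close>

fun symbol1 :: "bool \<Rightarrow> bool \<Rightarrow> (quat \<Rightarrow> complex) \<Rightarrow> complex" where
  "symbol1 False False f = (f 1 - \<i> * f quat_i) / 2"
| "symbol1 False True f = (f quat_j + \<i> * f quat_k) / 2"
| "symbol1 True False f = (- f quat_j + \<i> * f quat_k) / 2"
| "symbol1 True True f = (f 1 + \<i> * f quat_i) / 2"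

definition symbol :: "bool \<Rightarrow> 'n::finite \<times> bool \<Rightarrow> (quat ^ 'n \<Rightarrow> complex) \<Rightarrow> complex" where
  "symbol A' A f = symbol1 A' (snd A) (\<lambda>x. f (axis (fst A) x))"

lemma nabla_eq_symbol:
  "nabla A' A f q = symbol A' A (\<lambda>X. vector_derivative (\<lambda>t. f (q + t *\<^sub>R X)) (at 0))"
  by (cases A; cases A'; cases "snd A") (simp_all add: symbol_def pderiv_at_def)

lemma symbol1_add: "symbol1 A' a (\<lambda>x. f x + g x) = symbol1 A' a f + symbol1 A' a g"
  by (cases A'; cases a) (simp_all add: field_simps)

lemma symbol1_mult: "symbol1 A' a (\<lambda>x. c * f x) = c * symbol1 A' a f"
  by (cases A'; cases a) (simp_all add: field_simps)

lemma symbol1_sum: "symbol1 A' a (\<lambda>X. \<Sum>i\<in>S. f i X) = (\<Sum>i\<in>S. symbol1 A' a (f i))"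
proof (induction S rule: infinite_finite_induct)
  case (insert i S)
  then show ?case
    by (simp add: symbol1_add)
qed (use symbol1_mult[of A' a 0 "\<lambda>X. 0"] in simp_all)

lemma symbol_add: "symbol A' A (\<lambda>X. f X + g X) = symbol A' A f + symbol A' A g"
  by (simp add: symbol_def symbol1_add)

lemma symbol_mult: "symbol A' A (\<lambda>X. c * f X) = c * symbol A' A f"
  by (simp add: symbol_def symbol1_mult)

lemma symbol_mult_right: "symbol A' A (\<lambda>X. f X * c) = symbol A' A f * c"
  using symbol_mult[of A' A c f] by (simp add: mult.commute)

lemma symbol_minus: "symbol A' A (\<lambda>X. - f X) = - symbol A' A f"
  using symbol_mult[of A' A "-1" f] by simp

lemma symbol_diff: "symbol A' A (\<lambda>X. f X - g X) = symbol A' A f - symbol A' A g"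
  using symbol_add[of A' A f "\<lambda>X. - g X"] by (simp add: symbol_minus)

lemma symbol_sum: "symbol A' A (\<lambda>X. \<Sum>i\<in>S. f i X) = (\<Sum>i\<in>S. symbol A' A (f i))"
  by (simp add: symbol_def symbol1_sum)

lemma symbol_commute:
  "symbol A' A (\<lambda>X. symbol B' B (\<lambda>Y. f X Y)) = symbol B' B (\<lambda>Y. symbol A' A (\<lambda>X. f X Y))"
  by (cases A; cases "snd A"; cases A'; cases B; cases "snd B"; cases B')
    (simp_all add: symbol_def algebra_simps add_divide_distrib diff_divide_distrib)

lemma linear_quat_expand:
  fixes f :: "quat \<Rightarrow> complex"
  assumes "linear f"
  shows "f x = Q0 x * f 1 + Q1 x * f quat_i + Q2 x * f quat_j + Q3 x * f quat_k"
  proof -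
  have "x = Q0 x *\<^sub>R 1 + Q1 x *\<^sub>R quat_i + Q2 x *\<^sub>R quat_j + Q3 x *\<^sub>R quat_k"
      by (simp add: quat_eq_iff one_quat_def quat_i_def quat_j_def quat_k_def)
    then have "f x = f (Q0 x *\<^sub>R 1 + Q1 x *\<^sub>R quat_i + Q2 x *\<^sub>R quat_j + Q3 x *\<^sub>R quat_k)"
      by simp
    also have "\<dots> = Q0 x * f 1 + Q1 x * f quat_i + Q2 x * f quat_j + Q3 x * f quat_k"
      by (simp only: linear_add[OF assms] linear_cmul[OF assms] scaleR_conv_of_real[where 'a=complex])
    finally show ?thesis .
qed

text \<open>The complex two by two matrix of the vector of \<open>\<nabla>\<close> with indices \<open>A', a\<close> is the matrix unit in row
\<open>a\<close> and column \<open>A'\<close>. So left multiplication mixes the values of \<open>a\<close> and leaves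
\<open>A'\<close> alone, and right multiplication does the opposite. Both formulas are verified on the four units.\<close>

lemma symbol1_mult_left:
  assumes "linear f"
  shows "symbol1 A' a (\<lambda>x. f (w * x)) = (\<Sum>b\<in>UNIV. quat_emb w b a * symbol1 A' b f)"
proof -
  note f = linear_quat_expand[OF assms]
  have c: "Complex x y = of_real x + \<i> * of_real y" for x y
    by (simp add: complex_eq_iff)
  have g: "f (w * quat_i) = - Q1 w * f 1 + Q0 w * f quat_i + Q3 w * f quat_j - Q2 w * f quat_k"
    "f (w * quat_j) = - Q2 w * f 1 - Q3 w * f quat_i + Q0 w * f quat_j + Q1 w * f quat_k"
    "f (w * quat_k) = - Q3 w * f 1 + Q2 w * f quat_i - Q1 w * f quat_j + Q0 w * f quat_k"
    by (subst f, simp add: times_quat_def quat_i_def quat_j_def quat_k_def)+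
  show ?thesis
    by (cases A'; cases a) (simp_all add: UNIV_bool quat_emb_def c g f[of w] field_simps)
qed

lemma symbol1_mult_right:
  assumes "linear f"
  shows "symbol1 A' a (\<lambda>x. f (x * r)) = (\<Sum>B'\<in>UNIV. quat_emb r A' B' * symbol1 B' a f)"
proof -
  note f = linear_quat_expand[OF assms]
  have c: "Complex x y = of_real x + \<i> * of_real y" for x y
    by (simp add: complex_eq_iff)
  have g: "f (quat_i * r) = - Q1 r * f 1 + Q0 r * f quat_i - Q3 r * f quat_j + Q2 r * f quat_k"
    "f (quat_j * r) = - Q2 r * f 1 + Q3 r * f quat_i + Q0 r * f quat_j - Q1 r * f quat_k"
    "f (quat_k * r) = - Q3 r * f 1 - Q2 r * f quat_i + Q1 r * f quat_j + Q0 r * f quat_k"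
    by (subst f, simp add: times_quat_def quat_i_def quat_j_def quat_k_def)+
  show ?thesis
    by (cases A'; cases a) (simp_all add: UNIV_bool quat_emb_def c g f[of r] field_simps)
qed

lemma symbol_mult_vector:
  fixes f :: "quat ^ 'n::finite \<Rightarrow> complex"
  assumes "linear f"
  shows "symbol A' A (\<lambda>X. f (W *v X)) = (\<Sum>B\<in>UNIV. cmat W $ B $ A * symbol A' B f)"
proof -
  have W: "W *v axis l x = (\<Sum>m\<in>UNIV. axis m (W $ m $ l * x))" for l x
    by (simp add: vec_eq_iff matrix_vector_mult_def axis_def if_distrib[of "\<lambda>x. _ * x"] sum.delta' cong: if_cong)
  have lin: "linear (\<lambda>x. f (axis m x))" for m
    using linear_compose[OF linear_axis assms] by (simp add: o_def)
  have "symbol A' A (\<lambda>X. f (W *v X))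
      = (\<Sum>m\<in>UNIV. symbol1 A' (snd A) (\<lambda>x. f (axis m (W $ m $ fst A * x))))"
    by (simp add: symbol_def W linear_sum[OF assms] symbol1_sum)
  also have "\<dots> = (\<Sum>m\<in>UNIV. \<Sum>b\<in>UNIV. quat_emb (W $ m $ fst A) b (snd A) * symbol1 A' b (\<lambda>x. f (axis m x)))"
    by (simp add: symbol1_mult_left[OF lin])
  also have "\<dots> = (\<Sum>B\<in>UNIV. cmat W $ B $ A * symbol A' B f)"
    by (simp add: sum.cartesian_product split_beta cmat_def symbol_def flip: UNIV_Times_UNIV)
  finally show ?thesis .
qed

definition vmult_right :: "quat ^ 'n \<Rightarrow> quat \<Rightarrow> quat ^ 'n::finite" where
  "vmult_right X r = (\<chi> i. X $ i * r)"

lemma symbol_vmult_right: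
  fixes f :: "quat ^ 'n::finite \<Rightarrow> complex"
  assumes "linear f"
  shows "symbol A' A (\<lambda>X. f (vmult_right X r)) = (\<Sum>B'\<in>UNIV. quat_emb r A' B' * symbol B' A f)"
proof -
  have "vmult_right (axis l x) r = axis l (x * r)" for l :: 'n and x
    by (simp add: vmult_right_def vec_eq_iff axis_def)
  moreover have "linear (\<lambda>x. f (axis (fst A) x))"
    using linear_compose[OF linear_axis assms] by (simp add: o_def)
  from symbol1_mult_right[OF this]
  have "symbol1 A' (snd A) (\<lambda>x. f (axis (fst A) (x * r)))
    = (\<Sum>B'\<in>UNIV. quat_emb r A' B' * symbol1 B' (snd A) (\<lambda>x. f (axis (fst A) x)))" .
  ultimately show ?thesis
    by (simp add: symbol_def)
qed

definition row_mult :: "quat ^ 'n::finite \<Rightarrow> quat ^ 'n \<Rightarrow> quat" where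
  "row_mult e X = (\<Sum>l\<in>UNIV. e $ l * X $ l)"

text \<open>The complex matrix of \<open>row_mult e Y\<close> at the vector of \<open>\<nabla>\<close> with indices \<open>B', B\<close> has a single nonzero
column, with index \<open>B'\<close>. This is why the expressions below reduce to products.\<close>

lemma symbol_row_mult:
  "symbol B' B (\<lambda>Y. quat_emb (row_mult e Y) A' C')
    = (if B' = C' then quat_emb (e $ fst B) A' (snd B) else 0)"
proof -
  have "row_mult e (axis l x) = e $ l * x" for l x
    by (simp add: row_mult_def axis_def if_distrib[of "\<lambda>x. _ * x"] cong: if_cong)
  moreover have "symbol1 B' b (\<lambda>x. quat_emb (w * x) A' C') = (if B' = C' then quat_emb w A' b else 0)" for b w
    by (cases A'; cases B'; cases C'; cases b)
      (simp_all add: quat_emb_def times_quat_def one_quat_def quat_i_def quat_j_def quat_k_def complex_eq_iff)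
  ultimately show ?thesis
    by (simp add: symbol_def)
qed

lemma symbol_symbol_vmult_right:
  assumes "linear f"
  shows "symbol A' A (\<lambda>X. symbol B' B (\<lambda>Y. f (vmult_right X (row_mult e Y))))
    = quat_emb (e $ fst B) A' (snd B) * symbol B' A f"
proof -
  have "symbol A' A (\<lambda>X. symbol B' B (\<lambda>Y. f (vmult_right X (row_mult e Y))))
    = symbol B' B (\<lambda>Y. \<Sum>C'\<in>UNIV. quat_emb (row_mult e Y) A' C' * symbol C' A f)"
    \<comment> \<open>the inner functional is linear in \<open>X\<close>, so the factor on the right is moved out before \<open>Y\<close> is treated\<close>
    by (subst symbol_commute) (simp add: symbol_vmult_right[OF assms])
  also have "\<dots> = quat_emb (e $ fst B) A' (snd B) * symbol B' A f"
    by (simp add: symbol_sum symbol_mult_right symbol_row_mult if_distrib[of "\<lambda>x. x * _"] cong: if_cong)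
  finally show ?thesis .
qed

text \<open>Twice the real part of a quaternion is the trace of its complex matrix.\<close>

lemma symbol_row_mult_Re:
  "symbol B' B (\<lambda>Y. complex_of_real (2 * Q0 (row_mult e Y))) = quat_emb (e $ fst B) B' (snd B)"
proof -
  have "complex_of_real (2 * Q0 q) = quat_emb q False False + quat_emb q True True" for q
    by (simp add: quat_emb_def complex_eq_iff)
  then show ?thesis
    by (cases B') (simp_all only: symbol_add symbol_row_mult, simp_all)
qed

section \<open>Derivatives of projective maps and of weighted pullbacks\<close>

lemma linear_row_mult: "linear (row_mult e)"
  by (rule linearI) (simp_all add: row_mult_def distrib_left sum.distrib scaleR_sum_right)

lemma row_mult_scale: "row_mult (\<chi> l. r * e $ l) X = r * row_mult e X"
  by (simp add: row_mult_def sum_distrib_left mult.assoc)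

lemma vmult_right_add: "vmult_right (X + Y) r = vmult_right X r + vmult_right Y r"
  by (simp add: vmult_right_def vec_eq_iff distrib_right)

lemma vmult_right_scale: "vmult_right (c *\<^sub>R X) r = c *\<^sub>R vmult_right X r"
  by (simp add: vmult_right_def vec_eq_iff)

lemma row_mult_vmult_right: "row_mult e (vmult_right X r) = row_mult e X * r"
  by (simp add: row_mult_def vmult_right_def sum_distrib_right mult.assoc)

lemma matrix_mult_vmult_right: "W *v vmult_right X r = vmult_right (W *v X) r"
  by (simp add: vec_eq_iff matrix_vector_mult_def vmult_right_def sum_distrib_right mult.assoc)

lemma linear_matrix_mult: "linear (\<lambda>X. (W :: quat ^ 'n::finite ^ 'm) *v X)"
  by (rule linearI)
    (simp_all add: vec_eq_iff matrix_vector_mult_def distrib_left sum.distrib scaleR_sum_right)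

text \<open>The differential \<open>X \<mapsto> W X s\<^sup>-\<^sup>1\<close> of the action of \<open>h\<close> at \<open>x\<close>.\<close>

definition pact_deriv ::
    "quat ^ 'n::finite option ^ 'n option \<Rightarrow> quat ^ 'n \<Rightarrow> quat ^ 'n \<Rightarrow> quat ^ 'n" where
  "pact_deriv h x X = vmult_right (pact_factor h x *v X) (inverse (pdenom h x))"

lemma pdenom_row_mult: "pdenom h x = blk_a h + row_mult (blk_b h) x"
  by (simp add: pdenom_def row_mult_def)

lemma has_derivative_row_mult: "(row_mult b has_derivative row_mult b) F"
  using linear_row_mult[of b] unfolding linear_conv_bounded_linear by (rule bounded_linear_imp_has_derivative)

lemma has_derivative_pdenom: "(pdenom h has_derivative row_mult (blk_b h)) (at x)"
  unfolding pdenom_row_mult[abs_def] by (auto intro!: derivative_eq_intros has_derivative_row_mult)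

lemma pact_factor_mult: "(pact_factor h x *v X) $ i = (blk_d h *v X) $ i - pact h x $ i * row_mult (blk_b h) X"
  by (simp add: pact_factor_def matrix_vector_mult_def row_mult_def left_diff_distrib sum_subtractf
      sum_distrib_left mult.assoc)

lemma has_derivative_matrix_mult_nth:
  "((\<lambda>x. ((W :: quat ^ 'n::finite ^ 'm::finite) *v x) $ i) has_derivative (\<lambda>X. (W *v X) $ i)) F"
proof -
  have "linear (\<lambda>x. (W *v x) $ i)"
    using linear_matrix_mult[of W] by (simp add: linear_iff)
  then show ?thesis
    unfolding linear_conv_bounded_linear by (rule bounded_linear_imp_has_derivative)
qed

lemma has_derivative_pact:
  assumes "pdenom h x \<noteq> 0"
  shows "(pact h has_derivative pact_deriv h x) (at x)"
proof (rule has_derivative_vecI)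
  fix i
  have "((\<lambda>x. (blk_c h + blk_d h *v x) $ i * inverse (pdenom h x)) has_derivative
      (\<lambda>X. pact_deriv h x X $ i)) (at x)"
    unfolding vector_add_component
    by (rule derivative_eq_intros has_derivative_matrix_mult_nth has_derivative_pdenom assms refl)+
      (simp add: fun_eq_iff pact_deriv_def vmult_right_def pact_factor_mult pact_def algebra_simps)
  then show "((\<lambda>x. pact h x $ i) has_derivative (\<lambda>X. pact_deriv h x X $ i)) (at x)"
    by (simp add: pact_def)
qed

lemma has_derivative_vec_nth:
  fixes f :: "'a::real_normed_vector \<Rightarrow> quat ^ 'n::finite"
  assumes "(f has_derivative f') F"
  shows "((\<lambda>x. f x $ i) has_derivative (\<lambda>h. f' h $ i)) F"
  using bounded_linear.has_derivative[OF bounded_linear_vec_nth assms] .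

text \<open>The second derivative of the action is expressed through the first: with \<open>\<Psi> X = W X s\<^sup>-\<^sup>1\<close> and
\<open>E X = s\<^sup>-\<^sup>1 b X\<close> it is \<open>- \<Psi> (X (E Y)) - \<Psi> (Y (E X))\<close>. In this form its contribution to the
two-form can be compared with that of the derivatives of the weight.\<close>

lemma has_derivative_pact_deriv:
  assumes "pdenom h q \<noteq> 0"
  shows "((\<lambda>x. pact_deriv h x Y) has_derivative (\<lambda>X.
      - pact_deriv h q (vmult_right X (inverse (pdenom h q) * row_mult (blk_b h) Y))
      - pact_deriv h q (vmult_right Y (inverse (pdenom h q) * row_mult (blk_b h) X)))) (at q)"
proof (rule has_derivative_vecI)
  fix i
  have "((\<lambda>x. ((blk_d h *v Y) $ i - pact h x $ i * row_mult (blk_b h) Y) * inverse (pdenom h x)) has_derivative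
     (\<lambda>X. (- pact_deriv h q (vmult_right X (inverse (pdenom h q) * row_mult (blk_b h) Y))
      - pact_deriv h q (vmult_right Y (inverse (pdenom h q) * row_mult (blk_b h) X))) $ i)) (at q)"
    by (rule derivative_eq_intros has_derivative_vec_nth[OF has_derivative_pact] has_derivative_pdenom assms refl)+
      (simp add: fun_eq_iff pact_deriv_def vmult_right_def matrix_mult_vmult_right[unfolded vmult_right_def] pact_factor_mult algebra_simps)
  then show "((\<lambda>x. pact_deriv h x Y $ i) has_derivative
     (\<lambda>X. (- pact_deriv h q (vmult_right X (inverse (pdenom h q) * row_mult (blk_b h) Y))
      - pact_deriv h q (vmult_right Y (inverse (pdenom h q) * row_mult (blk_b h) X))) $ i)) (at q)"
    by (simp add: pact_deriv_def vmult_right_def[of "pact_factor h _ *v Y"] pact_factor_mult)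
qed

lemma Q0_inverse_mult: "inner s z * inverse ((norm s)\<^sup>2) = Q0 (inverse s * z)"
  by (simp add: power2_norm_eq_inner inverse_quat_def times_quat_def inner_quat_def algebra_simps)

text \<open>The logarithmic derivative of the weight \<open>|s|\<^sup>-\<^sup>2\<close> is \<open>- 2 Re (s\<^sup>-\<^sup>1 b X)\<close>, so it involves the same
quaternion \<open>E X\<close> as the second derivative of the action.\<close>

lemma has_derivative_weight:
  assumes "pdenom h x \<noteq> 0"
  shows "((\<lambda>x. inverse ((norm (pdenom h x))\<^sup>2)) has_derivative (\<lambda>X. - (inverse ((norm (pdenom h x))\<^sup>2)
      * (2 * Q0 (inverse (pdenom h x) * row_mult (blk_b h) X))))) (at x)"
proof -
  note s = has_derivative_pdenom[of h x]
  have "((\<lambda>x. inverse (pdenom h x \<bullet> pdenom h x)) has_derivative (\<lambda>X. - (inverse (pdenom h x \<bullet> pdenom h x)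
      * (pdenom h x \<bullet> row_mult (blk_b h) X + row_mult (blk_b h) X \<bullet> pdenom h x)
      * inverse (pdenom h x \<bullet> pdenom h x)))) (at x)"
    using assms by (intro Deriv.has_derivative_inverse has_derivative_inner s) simp
  then show ?thesis
    unfolding Q0_inverse_mult[symmetric] unfolding power2_norm_eq_inner
    by (simp add: inner_commute algebra_simps)
qed

lemma bounded_linear_Q0: "bounded_linear Q0"
  unfolding linear_conv_bounded_linear[symmetric] by (simp add: linear_iff)

lemmas has_derivative_Q0 = bounded_linear.has_derivative[OF bounded_linear_Q0]

lemma has_derivative_weight_log:
  assumes "pdenom h q \<noteq> 0"
  shows "((\<lambda>x. Q0 (inverse (pdenom h x) * row_mult (blk_b h) Y)) has_derivative (\<lambda>X.
     - Q0 (inverse (pdenom h q) * row_mult (blk_b h) X * (inverse (pdenom h q) * row_mult (blk_b h) Y)))) (at q)"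
proof -
  note s = has_derivative_pdenom[of h q]
  have "((\<lambda>x. Q0 (inverse (pdenom h x) * row_mult (blk_b h) Y)) has_derivative (\<lambda>X.
     Q0 (- (inverse (pdenom h q) * row_mult (blk_b h) X * inverse (pdenom h q)) * row_mult (blk_b h) Y))) (at q)"
    by (intro has_derivative_Q0 has_derivative_mult_left Deriv.has_derivative_inverse s assms)
  then show ?thesis
    by (simp add: mult.assoc)
qed

text \<open>The second derivative of \<open>|s|\<^sup>-\<^sup>2 (v o h)\<close> by the product and chain rules, with \<open>row_mult e X\<close> equal
to \<open>E X = s\<^sup>-\<^sup>1 b X\<close>. The terms are grouped by the order of the derivative of \<open>v\<close>.\<close>

lemma weighted_pullback_derivatives:
  fixes v u :: "quat ^ 'n::finite \<Rightarrow> real" and h :: "quat ^ 'n option ^ 'n option" and q :: "quat ^ 'n"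
  assumes C2: "Ck_on (Suc (Suc 0)) T v" and T: "open T" and N: "open N" "q \<in> N" "pact h ` N \<subseteq> T"
    and s: "\<forall>x\<in>N. pdenom h x \<noteq> 0"
    and u: "\<forall>x\<in>N. u x = inverse ((norm (pdenom h x))\<^sup>2) * v (pact h x)"
  defines "\<rho> \<equiv> inverse ((norm (pdenom h q))\<^sup>2)"
    and "e \<equiv> \<chi> l. inverse (pdenom h q) * blk_b h $ l"
    and "l \<equiv> \<lambda>X. frechet_derivative v (at (pact h q)) (pact_deriv h q X)"
  defines "D \<equiv> \<lambda>x Y. inverse ((norm (pdenom h x))\<^sup>2) *
    (frechet_derivative v (at (pact h x)) (pact_deriv h x Y)
      - 2 * Q0 (inverse (pdenom h x) * row_mult (blk_b h) Y) * v (pact h x))"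
  shows "\<forall>x\<in>N. (u has_derivative D x) (at x)"
    and "((\<lambda>x. D x Y) has_derivative (\<lambda>X. \<rho> *
        (v (pact h q) * (2 * Q0 (row_mult e X) * (2 * Q0 (row_mult e Y)) + 2 * Q0 (row_mult e (vmult_right X (row_mult e Y))))
         - 2 * Q0 (row_mult e X) * l Y - 2 * Q0 (row_mult e Y) * l X
         - l (vmult_right X (row_mult e Y)) - l (vmult_right Y (row_mult e X))
         + second_deriv v (pact h q) (pact_deriv h q X) (pact_deriv h q Y)))) (at q)"
proof -
  have v: "((\<lambda>x. v (pact h x)) has_derivative (\<lambda>X. frechet_derivative v (at (pact h x)) (pact_deriv h x X))) (at x)"
    if "x \<in> N" for x
    using N(3) that by (intro has_derivative_compose[OF has_derivative_pact C2_derivatives(1)[OF C2]])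
      (use s in auto)
  have E: "inverse (pdenom h q) * row_mult (blk_b h) X = row_mult e X" for X
    unfolding e_def by (simp add: row_mult_scale)
  show "\<forall>x\<in>N. (u has_derivative D x) (at x)"
  proof
    fix x assume x: "x \<in> N"
    have "((\<lambda>x. inverse ((norm (pdenom h x))\<^sup>2) * v (pact h x)) has_derivative D x) (at x)"
      by (rule has_derivative_eq_rhs[OF has_derivative_mult[OF has_derivative_weight[OF s[rule_format, OF x]] v[OF x]]])
        (simp add: D_def fun_eq_iff algebra_simps)
    then show "(u has_derivative D x) (at x)"
      by (rule has_derivative_transform_within_open[OF _ N(1) x]) (simp add: u)
  qed
  note s_q = s[rule_format, OF N(2)]
  have lin: "linear (frechet_derivative v (at (pact h q)))"
    using N C2_derivatives(1)[OF C2] by (intro has_derivative_linear) auto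
  note chain = has_derivative_frechet_derivative_chain[OF C2 T N has_derivative_pact[OF s_q]
      has_derivative_pact_deriv[OF s_q, of Y]]
  show "((\<lambda>x. D x Y) has_derivative (\<lambda>X. \<rho> *
      (v (pact h q) * (2 * Q0 (row_mult e X) * (2 * Q0 (row_mult e Y)) + 2 * Q0 (row_mult e (vmult_right X (row_mult e Y))))
       - 2 * Q0 (row_mult e X) * l Y - 2 * Q0 (row_mult e Y) * l X
       - l (vmult_right X (row_mult e Y)) - l (vmult_right Y (row_mult e X))
       + second_deriv v (pact h q) (pact_deriv h q X) (pact_deriv h q Y)))) (at q)"
    unfolding D_def
    by (rule has_derivative_eq_rhs[OF has_derivative_mult[OF has_derivative_weight[OF s_q]
          has_derivative_diff[OF chain has_derivative_mult[OF
              has_derivative_mult_right[OF has_derivative_weight_log[OF s_q, of Y]] v[OF N(2)]]]]])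
      (simp add: fun_eq_iff E row_mult_vmult_right \<rho>_def l_def linear_diff[OF lin] linear_neg[OF lin] algebra_simps)
qed

section \<open>The two-form of a weighted pullback\<close>

lemma dform_form_const:
  "dform A' (\<lambda>q. form_const (v q)) p = (\<lambda>L. \<Sum>B\<in>UNIV. nabla A' B v p * gen B L)"
  for v :: "quat ^ 'n::{finite,linorder} \<Rightarrow> complex"
proof -
  have "nabla A' B (\<lambda>p. 0 :: complex) p = 0" for B
    by (cases A'; cases B; cases "snd B") (simp_all add: pderiv_at_def)
  then have "(\<lambda>J. nabla A' B (\<lambda>q. form_const (v q) J) p) = (\<lambda>J :: ('n \<times> bool) set. nabla A' B v p * form_const 1 J)" for B
    by (auto simp: form_const_def fun_eq_iff)
  then show ?thesis
    unfolding dform_def by (simp add: wedge_scale_right gen_wedge_one)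
qed

text \<open>The coefficient functions of \<open>d v\<close> with upper index \<open>1'\<close> are supported on singletons, and at a singleton the
sum over \<open>B\<close> has only one term. So the outer operator passes through the sum, although it is additive only on functions with
partial derivatives.\<close>

lemma triangle_op_two_form:
  fixes v :: "quat ^ 'n::{finite,linorder} \<Rightarrow> complex"
  shows "triangle_op v q = two_form gen (\<lambda>A B. nabla False A (nabla True B v) q)"
proof -
  have z: "nabla A' B (\<lambda>p. 0 :: complex) q = 0" for A' and B :: "'n \<times> bool"
    by (cases A'; cases B; cases "snd B") (simp_all add: pderiv_at_def)
  have "nabla False A (\<lambda>p. \<Sum>B\<in>UNIV. nabla True B v p * gen B J) q
    = (\<Sum>B\<in>UNIV. nabla False A (nabla True B v) q * gen B J)" for A J
  proof (cases "\<exists>B. J = {B}")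
    case True
    then obtain B where "J = {B}" ..
    then have "(\<Sum>C\<in>UNIV. f C * gen C J) = f B" for f
      by (simp add: gen_def if_distrib[of "\<lambda>x. _ * x"] cong: if_cong)
    then show ?thesis
      by simp
  next
    case False
    then have "gen B J = 0" for B
      unfolding gen_def by metis
    then show ?thesis
      by (simp add: z)
  qed
  then show ?thesis
    unfolding triangle_op_def dform_form_const[abs_def]
    by (simp add: dform_def two_form_def wedge_sum_right fun_eq_iff)
qed

lemma has_vector_derivative_symbol1:
  assumes "\<And>Y. ((\<lambda>t. f t Y) has_vector_derivative f' Y) F"
  shows "((\<lambda>t. symbol1 B' b (f t)) has_vector_derivative symbol1 B' b f') F"
proof (cases B'; cases b)
qed (auto intro!: derivative_eq_intros assms simp: field_simps)

lemma nabla_nabla_real: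
  fixes v :: "quat ^ 'n::finite \<Rightarrow> real"
  assumes "open N" "q \<in> N"
    and D: "\<forall>x\<in>N. (v has_derivative D x) (at x)"
    and H: "\<And>Y. ((\<lambda>x. D x Y) has_derivative (\<lambda>X. H X Y)) (at q)"
  shows "nabla A' A (\<lambda>x. nabla B' B (\<lambda>p. complex_of_real (v p)) x) q
    = symbol A' A (\<lambda>X. symbol B' B (\<lambda>Y. complex_of_real (H X Y)))"
proof -
  have line: "((\<lambda>t. g (x + t *\<^sub>R X)) has_vector_derivative g' X) (at 0)"
    if "(g has_derivative g') (at x)" for g :: "quat ^ 'n \<Rightarrow> real" and g' x X
    using has_real_derivative_along_line[of g g' x 0 X] that
    by (simp add: has_real_derivative_iff_has_vector_derivative)
  have of_real: "((\<lambda>t. complex_of_real (g t)) has_vector_derivative complex_of_real d) (at 0)"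
    if "(g has_vector_derivative d) (at 0)" for g d
    by (rule bounded_linear.has_vector_derivative[OF bounded_linear_of_real that])
  have nv: "nabla B' B (\<lambda>p. complex_of_real (v p)) x = symbol B' B (\<lambda>Y. complex_of_real (D x Y))"
    if "x \<in> N" for x
    unfolding nabla_eq_symbol vector_derivative_at[OF of_real[OF line[OF D[rule_format, OF that]]]] ..
  have "((\<lambda>t. nabla B' B (\<lambda>p. complex_of_real (v p)) (q + t *\<^sub>R X)) has_vector_derivative
      symbol B' B (\<lambda>Y. complex_of_real (H X Y))) (at 0)" for X
  proof -
    have "((\<lambda>t. symbol B' B (\<lambda>Y. complex_of_real (D (q + t *\<^sub>R X) Y))) has_vector_derivative
      symbol B' B (\<lambda>Y. complex_of_real (H X Y))) (at 0)"
      unfolding symbol_def by (intro has_vector_derivative_symbol1 of_real line H)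
    moreover have "open ((\<lambda>t. q + t *\<^sub>R X) -` N)"
      by (intro open_vimage \<open>open N\<close> continuous_intros)
    ultimately show ?thesis
      by (rule has_vector_derivative_transform_within_open) (use \<open>q \<in> N\<close> nv in auto)
  qed
  note vd = this
  show ?thesis
    unfolding nabla_eq_symbol[of A' A] vector_derivative_at[OF vd] ..
qed

lemma linear_of_real_comp: "linear f \<Longrightarrow> linear (\<lambda>x. complex_of_real (f x))"
  by (simp add: linear_iff scaleR_conv_of_real)

lemma symbol_pact_deriv:
  assumes "linear f"
  shows "symbol A' A (\<lambda>X. f (pact_deriv h q X)) = (\<Sum>B\<in>UNIV. cmat (pact_factor h q) $ B $ A *
      (\<Sum>B'\<in>UNIV. quat_emb (inverse (pdenom h q)) A' B' * symbol B' B f))"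
proof -
  have "linear (\<lambda>X. f (vmult_right X (inverse (pdenom h q))))"
    using assms by (simp add: linear_iff vmult_right_add vmult_right_scale)
  from symbol_mult_vector[OF this] show ?thesis
    unfolding pact_deriv_def by (simp add: symbol_vmult_right[OF assms])
qed

text \<open>Let \<open>r = s\<^sup>-\<^sup>1\<close>. Moving the factors of \<open>W X r\<close> and \<open>W Y r\<close> out of \<open>H\<close> leaves a sum over the primed indices
\<open>C', D'\<close> with the coefficients \<open>r\<^sub>0\<^sub>C\<^sub>' r\<^sub>1\<^sub>D\<^sub>'\<close>. As \<open>H\<close> is symmetric, exchanging \<open>C'\<close> and \<open>D'\<close> amounts to
exchanging \<open>C\<close> and \<open>D\<close>. So, up to terms symmetric in \<open>C, D\<close>, the coefficients are antisymmetrized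
and the sum is the determinant \<open>|r|\<^sup>2\<close> times the term with \<open>C' = 0'\<close> and \<open>D' = 1'\<close>.\<close>

lemma symbol_symbol_pact_deriv:
  fixes H :: "quat ^ 'n::finite \<Rightarrow> quat ^ 'n \<Rightarrow> complex"
    and h :: "quat ^ 'n option ^ 'n option" and q :: "quat ^ 'n"
  assumes lin1: "\<And>Y. linear (\<lambda>X. H X Y)" and lin2: "\<And>X. linear (\<lambda>Y. H X Y)" and sym: "\<And>X Y. H X Y = H Y X"
  defines "W \<equiv> cmat (pact_factor h q)" and "Z \<equiv> \<lambda>A' A B' B. symbol A' A (\<lambda>X. symbol B' B (\<lambda>Y. H X Y))"
  obtains \<sigma> where "\<And>A B. \<sigma> A B = \<sigma> B A" and
    "\<And>A B. symbol False A (\<lambda>X. symbol True B (\<lambda>Y. H (pact_deriv h q X) (pact_deriv h q Y)))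
      = complex_of_real (inverse ((norm (pdenom h q))\<^sup>2)) *
        (\<Sum>C\<in>UNIV. \<Sum>D\<in>UNIV. W $ C $ A * W $ D $ B * Z False C True D) + \<sigma> A B"
proof -
  define r where "r = inverse (pdenom h q)"
  have Z_sym: "Z A' A B' B = Z B' B A' A" for A' A B' B
    unfolding Z_def by (subst symbol_commute) (simp add: sym)
  have expand: "symbol False A (\<lambda>X. symbol True B (\<lambda>Y. H (pact_deriv h q X) (pact_deriv h q Y)))
    = (\<Sum>C\<in>UNIV. \<Sum>D\<in>UNIV. W $ C $ A * W $ D $ B *
        (\<Sum>C'\<in>UNIV. \<Sum>D'\<in>UNIV. quat_emb r False C' * quat_emb r True D' * Z C' C D' D))" for A B
  proof -
    have lz: "linear (\<lambda>X. symbol D' D (\<lambda>Y. H X Y))" for D' D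
      by (rule linearI)
        (simp_all add: linear_add[OF lin1] linear_cmul[OF lin1] symbol_add symbol_mult scaleR_conv_of_real[where 'a=complex])
    have "symbol False A (\<lambda>X. symbol True B (\<lambda>Y. H (pact_deriv h q X) (pact_deriv h q Y)))
      = (\<Sum>D\<in>UNIV. W $ D $ B * (\<Sum>D'\<in>UNIV. quat_emb r True D' *
          symbol False A (\<lambda>X. symbol D' D (\<lambda>Y. H (pact_deriv h q X) Y))))"
      by (simp add: symbol_pact_deriv[OF lin2] symbol_sum symbol_mult W_def r_def)
    also have "\<dots> = (\<Sum>D\<in>UNIV. W $ D $ B * (\<Sum>D'\<in>UNIV. quat_emb r True D' *
          (\<Sum>C\<in>UNIV. W $ C $ A * (\<Sum>C'\<in>UNIV. quat_emb r False C' * Z C' C D' D))))"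
      by (simp add: symbol_pact_deriv[OF lz] W_def r_def Z_def)
    also have "\<dots> = (\<Sum>D\<in>UNIV. \<Sum>C\<in>UNIV. W $ C $ A * W $ D $ B *
        (\<Sum>C'\<in>UNIV. \<Sum>D'\<in>UNIV. quat_emb r False C' * quat_emb r True D' * Z C' C D' D))"
      by (simp add: UNIV_bool sum_distrib_left sum.distrib algebra_simps)
    also have "\<dots> = (\<Sum>C\<in>UNIV. \<Sum>D\<in>UNIV. W $ C $ A * W $ D $ B *
        (\<Sum>C'\<in>UNIV. \<Sum>D'\<in>UNIV. quat_emb r False C' * quat_emb r True D' * Z C' C D' D))"
      by (rule sum.swap)
    finally show ?thesis .
  qed
  \<comment> \<open>what remains after the term with \<open>C' = 0'\<close>, \<open>D' = 1'\<close> has received the full determinant\<close>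
  define S where "S C D = quat_emb r False False * quat_emb r True False * Z False C False D
     + quat_emb r False True * quat_emb r True True * Z True C True D
     + quat_emb r False True * quat_emb r True False * (Z False C True D + Z True C False D)" for C D
  have S_sym: "S C D = S D C" for C D
    using Z_sym[of False C False D] Z_sym[of True C True D] Z_sym[of False C True D] Z_sym[of True C False D]
    by (simp add: S_def)
  have split: "(\<Sum>C'\<in>UNIV. \<Sum>D'\<in>UNIV. quat_emb r False C' * quat_emb r True D' * Z C' C D' D)
    = complex_of_real ((norm r)\<^sup>2) * Z False C True D + S C D" for C D
    unfolding quat_emb_det[symmetric] by (simp add: UNIV_bool S_def algebra_simps)
  show ?thesis
  proof
    show "(\<Sum>C\<in>UNIV. \<Sum>D\<in>UNIV. W $ C $ A * W $ D $ B * S C D)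
      = (\<Sum>C\<in>UNIV. \<Sum>D\<in>UNIV. W $ C $ B * W $ D $ A * S C D)" for A B
      by (subst sum.swap) (simp add: S_sym mult_ac)
    show "symbol False A (\<lambda>X. symbol True B (\<lambda>Y. H (pact_deriv h q X) (pact_deriv h q Y)))
      = complex_of_real (inverse ((norm (pdenom h q))\<^sup>2)) *
        (\<Sum>C\<in>UNIV. \<Sum>D\<in>UNIV. W $ C $ A * W $ D $ B * Z False C True D)
        + (\<Sum>C\<in>UNIV. \<Sum>D\<in>UNIV. W $ C $ A * W $ D $ B * S C D)" for A B
      unfolding expand split
      by (simp add: r_def norm_inverse power_inverse distrib_left sum.distrib sum_distrib_left mult_ac)
  qed
qed

text \<open>The cancellation that singles out the weight \<open>-2\<close>. Here \<open>c\<close> is the value of \<open>v\<close>, and \<open>l\<close> is its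
differential composed with the differential of the action. Write \<open>\<epsilon>\<^sub>B\<^sub>'\<^sub>B\<close> for the entries of the complex
matrices of \<open>e\<close>. A product with a first derivative \<open>\<tau>\<close> of the weight
contributes \<open>\<epsilon>\<close> with the indices of the argument of \<open>\<tau>\<close>. The second derivatives of the weight and of
the action bring in a right multiplication by \<open>row_mult e Y\<close>, which exchanges the primed indices of the two
factors (\<open>symbol_symbol_vmult_right\<close>). The terms of the second kind are thereby those of the first
kind with \<open>A\<close> and \<open>B\<close> exchanged.\<close>

lemma lower_order_symmetric:
  fixes l :: "quat ^ 'n::finite \<Rightarrow> complex" and e :: "quat ^ 'n" and c :: complex
  assumes l: "linear l"
  defines "\<tau> \<equiv> \<lambda>X. complex_of_real (2 * Q0 (row_mult e X))"
  defines "\<sigma> \<equiv> \<lambda>A B. symbol False A (\<lambda>X. symbol True B (\<lambda>Y.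
      c * (\<tau> X * \<tau> Y + \<tau> (vmult_right X (row_mult e Y))) - \<tau> X * l Y - \<tau> Y * l X
      - l (vmult_right X (row_mult e Y)) - l (vmult_right Y (row_mult e X))))"
  shows "\<sigma> A B = \<sigma> B A"
proof -
  have \<tau>: "linear \<tau>"
    unfolding \<tau>_def using linear_row_mult[of e]
    by (intro linear_of_real_comp) (simp add: linear_iff algebra_simps)
  define \<epsilon> where "\<epsilon> B' B = quat_emb (e $ fst B) B' (snd B)" for B' and B :: "'n \<times> bool"
  have z\<tau>: "symbol B' B \<tau> = \<epsilon> B' B" for B' B
    unfolding \<tau>_def \<epsilon>_def by (rule symbol_row_mult_Re)
  have K: "symbol A' A (\<lambda>X. symbol B' B (\<lambda>Y. f (vmult_right X (row_mult e Y)))) = \<epsilon> A' B * symbol B' A f"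
    "symbol A' A (\<lambda>X. symbol B' B (\<lambda>Y. f (vmult_right Y (row_mult e X)))) = \<epsilon> B' A * symbol A' B f"
    if "linear f" for f A' A B' B
    using symbol_symbol_vmult_right[OF that, of A' A B' B e] symbol_symbol_vmult_right[OF that, of B' B A' A e]
    unfolding \<epsilon>_def by (simp_all add: symbol_commute[of A' A B' B])
  have "\<sigma> A B = c * (\<epsilon> False A * \<epsilon> True B + \<epsilon> False B * \<epsilon> True A) - \<epsilon> False A * symbol True B l
      - symbol False A l * \<epsilon> True B - \<epsilon> False B * symbol True A l - \<epsilon> True A * symbol False B l" for A B
    unfolding \<sigma>_def
    by (simp add: symbol_add symbol_diff symbol_mult symbol_mult_right K[OF \<tau>] K[OF l] z\<tau> mult.commute[of "symbol _ _ l"] mult.commute)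
  note eq = this
  show ?thesis
    unfolding eq by (simp add: algebra_simps)
qed

section \<open>The Monge-Ampere operator and the change of charts\<close>

lemma MA_eq:
  fixes v :: "quat ^ 'n::{finite,linorder} \<Rightarrow> complex"
  shows "MA v q = wedge_power (triangle_op v q) CARD('n) UNIV / (Omega :: 'n form) UNIV"
proof -
  have "wedge_power (triangle_op v q) CARD('n) = (\<lambda>L. MA v q * Omega L)"
    unfolding MA_def by (rule theI'[OF MA_ex1])
  then have "wedge_power (triangle_op v q) CARD('n) UNIV = MA v q * (Omega :: 'n form) UNIV"
    by simp
  moreover have "(Omega :: 'n form) UNIV \<noteq> 0"
  proof -
    obtain s where "s \<noteq> 0" "(Omega :: 'n form) = (\<lambda>L. if L = UNIV then s else 0)"
      using Omega_top by blast
    then show ?thesis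
      by (metis (full_types))
  qed
  ultimately show ?thesis
    by simp
qed

text \<open>Invariance in one pair of charts. The two-form of \<open>u\<close> is \<open>\<rho>\<^sup>2\<close> times the two-form of \<open>v\<close> with \<open>W\<close>
substituted, where \<open>\<rho> = |s|\<^sup>-\<^sup>2\<close>: one factor \<open>\<rho>\<close> is the weight itself, the other comes from the right factor
\<open>s\<^sup>-\<^sup>1\<close> of the differential. The \<open>n\<close>-th power contributes \<open>\<rho>\<close> to the power \<open>2 n\<close> and the determinant of
\<open>W\<close>, which equals \<open>\<rho>\<close> because \<open>h\<close> has determinant \<open>1\<close>.\<close>

lemma MA_weighted_pullback:
  fixes v u :: "quat ^ 'n::{finite,linorder} \<Rightarrow> real" and h :: "quat ^ 'n::{finite,linorder} option ^ 'n::{finite,linorder} option" and q :: "quat ^ 'n::{finite,linorder}"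
  assumes h: "det (cmat h) = 1"
    and C2: "Ck_on (Suc (Suc 0)) T v" and T: "open T" and N: "open N" "q \<in> N" "pact h ` N \<subseteq> T"
    and s: "\<forall>x\<in>N. pdenom h x \<noteq> 0"
    and u: "\<forall>x\<in>N. u x = inverse ((norm (pdenom h x))\<^sup>2) * v (pact h x)"
  shows "MA (\<lambda>p. complex_of_real (u p)) q = complex_of_real (inverse ((norm (pdenom h q))\<^sup>2)) ^ (2 * CARD('n) + 1)
      * MA (\<lambda>p. complex_of_real (v p)) (pact h q)"
proof -
  define \<rho> where "\<rho> = complex_of_real (inverse ((norm (pdenom h q))\<^sup>2))"
  define e where "e = (\<chi> l. inverse (pdenom h q) * blk_b h $ l)"
  define l where "l X = complex_of_real (frechet_derivative v (at (pact h q)) (pact_deriv h q X))" for X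
  define \<tau> where "\<tau> X = complex_of_real (2 * Q0 (row_mult e X))" for X
  define W where "W = cmat (pact_factor h q)"
  let ?p = "pact h q" and ?\<Psi> = "pact_deriv h q"
  let ?H = "\<lambda>X Y. complex_of_real (second_deriv v ?p X Y)"
  define tv where "tv A B = nabla False A (nabla True B (\<lambda>p. complex_of_real (v p))) ?p" for A B
  define tu where "tu A B = nabla False A (nabla True B (\<lambda>p. complex_of_real (u p))) q" for A B
  have p: "?p \<in> T"
    using N by auto
  have tv: "tv A B = symbol False A (\<lambda>X. symbol True B (\<lambda>Y. ?H X Y))" for A B
    unfolding tv_def by (rule nabla_nabla_real[OF T p _ C2_derivatives(2)[OF C2 p]])
      (use C2_derivatives(1)[OF C2] in blast)
  have linv: "linear (frechet_derivative v (at ?p))"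
    using C2_derivatives(1)[OF C2 p] by (rule has_derivative_linear)
  have lin\<Psi>: "linear ?\<Psi>"
    using has_derivative_pact[OF s[rule_format, OF N(2)]] by (rule has_derivative_linear)
  have linl: "linear l"
    unfolding l_def using linear_compose[OF lin\<Psi> linv] by (intro linear_of_real_comp) (simp add: o_def)
  have lin: "linear (\<lambda>X. ?H X Y)" "linear (\<lambda>Y. ?H X Y)" "?H X Y = ?H Y X" for X Y
    using second_deriv_linear[OF C2 T p] second_deriv_symmetric[OF C2 T p, of X Y]
    by (simp_all add: linear_of_real_comp)
  obtain \<sigma> where \<sigma>_sym: "\<And>A B. \<sigma> A B = \<sigma> B A" and \<sigma>:
    "\<And>A B. symbol False A (\<lambda>X. symbol True B (\<lambda>Y. ?H (?\<Psi> X) (?\<Psi> Y)))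
      = \<rho> * (\<Sum>C\<in>UNIV. \<Sum>D\<in>UNIV. W $ C $ A * W $ D $ B * tv C D) + \<sigma> A B"
    using that unfolding \<rho>_def W_def tv by (rule symbol_symbol_pact_deriv[of ?H h q, OF lin])
  \<comment> \<open>the lower-order part, with the common factor \<open>\<rho>\<close> taken out\<close>
  define \<sigma>' where "\<sigma>' A B = symbol False A (\<lambda>X. symbol True B (\<lambda>Y.
      complex_of_real (v ?p) * (\<tau> X * \<tau> Y + \<tau> (vmult_right X (row_mult e Y))) - \<tau> X * l Y - \<tau> Y * l X
      - l (vmult_right X (row_mult e Y)) - l (vmult_right Y (row_mult e X))))" for A B
  have \<sigma>'_sym: "\<sigma>' A B = \<sigma>' B A" for A B
    unfolding \<sigma>'_def \<tau>_def by (rule lower_order_symmetric[OF linl])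
  note D = weighted_pullback_derivatives[OF C2 T N s u]
  have "tu A B = symbol False A (\<lambda>X. symbol True B (\<lambda>Y. \<rho> *
      (complex_of_real (v ?p) * (\<tau> X * \<tau> Y + \<tau> (vmult_right X (row_mult e Y))) - \<tau> X * l Y - \<tau> Y * l X
      - l (vmult_right X (row_mult e Y)) - l (vmult_right Y (row_mult e X)) + ?H (?\<Psi> X) (?\<Psi> Y))))" for A B
    unfolding tu_def \<rho>_def \<tau>_def l_def e_def by (subst nabla_nabla_real[OF N(1,2) D]) simp
  then have tu: "tu A B = \<rho> * \<rho> * (\<Sum>C\<in>UNIV. \<Sum>D\<in>UNIV. W $ C $ A * W $ D $ B * tv C D)
      + \<rho> * (\<sigma> A B + \<sigma>' A B)" for A B
    by (simp only: symbol_mult symbol_add \<sigma>'_def[symmetric] \<sigma>) (simp add: algebra_simps)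
  have "two_form gen tu = two_form gen (\<lambda>A B. \<rho> * \<rho> * (\<Sum>C\<in>UNIV. \<Sum>D\<in>UNIV. W $ C $ A * W $ D $ B * tv C D))"
    unfolding tu[abs_def] by (rule two_form_gen_symmetric) (simp add: \<sigma>_sym \<sigma>'_sym)
  also have "\<dots> = (\<lambda>L. \<rho> * \<rho> * two_form (subst_gen W) tv L)"
    unfolding two_form_subst_gen two_form_scale ..
  finally have "triangle_op (\<lambda>p. complex_of_real (u p)) q = (\<lambda>L. \<rho> * \<rho> * two_form (subst_gen W) tv L)"
    unfolding triangle_op_two_form tu_def[abs_def] .
  then have "wedge_power (triangle_op (\<lambda>p. complex_of_real (u p)) q) CARD('n)
    = (\<lambda>L. (\<rho> * \<rho>) ^ CARD('n) * (det W * wedge_power (triangle_op (\<lambda>p. complex_of_real (v p)) ?p) CARD('n) L))"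
    by (simp only: wedge_power_scale wedge_power_subst_gen)
      (simp only: triangle_op_two_form tv_def[abs_def])
  moreover have "det W = \<rho>"
    using det_pact_factor[OF s[rule_format, OF N(2)]] h s[rule_format, OF N(2)] unfolding W_def \<rho>_def
    by (simp add: field_simps)
  ultimately show ?thesis
    unfolding MA_eq \<rho>_def[symmetric]
    by (simp add: power_mult power2_eq_square power_mult_distrib)
qed

lemma transition_domains:
  assumes "qp_flat_atlas M I U \<phi> g" "\<alpha> \<in> I" "\<beta> \<in> I"
  shows "inj_on (\<phi> \<alpha>) (U \<alpha>)" "open (\<phi> \<alpha> ` (U \<alpha> \<inter> U \<beta>))"
    and "x \<in> U \<alpha> \<Longrightarrow> x \<in> U \<beta> \<Longrightarrow> \<phi> \<beta> x = pact (matrix_inv (g \<alpha> \<beta>)) (\<phi> \<alpha> x)"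
proof -
  have o: "openin M (U \<alpha>)" "openin M (U \<beta>)" "open (\<phi> \<alpha> ` U \<alpha>)"
    and hom: "homeomorphic_map (subtopology M (U \<alpha>)) (top_of_set (\<phi> \<alpha> ` U \<alpha>)) (\<phi> \<alpha>)"
    using assms unfolding qp_flat_atlas_def by auto
  have top: "topspace (subtopology M (U \<alpha>)) = U \<alpha>"
    using openin_subset[OF o(1)] by auto
  show inj: "inj_on (\<phi> \<alpha>) (U \<alpha>)"
    using homeomorphic_imp_injective_map[OF hom] unfolding top .
  have "openin (subtopology M (U \<alpha>)) (U \<alpha> \<inter> U \<beta>)"
    using o by (auto simp: openin_subtopology)
  then have "openin (top_of_set (\<phi> \<alpha> ` U \<alpha>)) (\<phi> \<alpha> ` (U \<alpha> \<inter> U \<beta>))"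
    using homeomorphic_imp_open_map[OF hom] unfolding open_map_def by blast
  then show "open (\<phi> \<alpha> ` (U \<alpha> \<inter> U \<beta>))"
    using o(3) openin_open_trans by blast
  show "\<phi> \<beta> x = pact (matrix_inv (g \<alpha> \<beta>)) (\<phi> \<alpha> x)" if x: "x \<in> U \<alpha>" "x \<in> U \<beta>"
  proof -
    have "\<phi> \<beta> (inv_into (U \<alpha>) (\<phi> \<alpha>) (\<phi> \<alpha> x)) = pact (matrix_inv (g \<alpha> \<beta>)) (\<phi> \<alpha> x)"
      using assms x unfolding qp_flat_atlas_def by blast
    then show ?thesis
      by (simp add: inv_into_f_f[OF inj x(1)])
  qed
qed

theorem proposition6p1:
  fixes M :: "'m topology"
    and I :: "'i set"
    and U :: "'i \<Rightarrow> 'm set"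
    and \<phi> :: "'i \<Rightarrow> 'm \<Rightarrow> quat ^ 'n::{finite,linorder}"
    and g :: "'i \<Rightarrow> 'i \<Rightarrow> quat ^ 'n option ^ 'n option"
    and u :: "'i \<Rightarrow> quat ^ 'n::{finite,linorder} \<Rightarrow> real"
  assumes atlas: "qp_flat_atlas M I U \<phi> g"
    and section_u: "smooth_section I U \<phi> g u"
  shows "(\<forall>\<alpha>\<in>I. \<forall>\<beta>\<in>I. \<forall>q \<in> \<phi> \<alpha> ` (U \<alpha> \<inter> U \<beta>). u \<alpha> q \<noteq> 0 \<longrightarrow>
            MA (\<lambda>p. complex_of_real (u \<alpha> p)) q / complex_of_real (u \<alpha> q) ^ (2 * CARD('n) + 1)
            = MA (\<lambda>p. complex_of_real (u \<beta> p)) (pact (matrix_inv (g \<alpha> \<beta>)) q)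
              / complex_of_real (u \<beta> (pact (matrix_inv (g \<alpha> \<beta>)) q)) ^ (2 * CARD('n) + 1))
       \<and> (\<exists>F :: 'm \<Rightarrow> complex. \<forall>\<alpha>\<in>I. \<forall>x\<in>U \<alpha>. u \<alpha> (\<phi> \<alpha> x) \<noteq> 0 \<longrightarrow>
            F x = MA (\<lambda>p. complex_of_real (u \<alpha> p)) (\<phi> \<alpha> x)
                    / complex_of_real (u \<alpha> (\<phi> \<alpha> x)) ^ (2 * CARD('n) + 1))"
proof -
  let ?R = "\<lambda>\<alpha> q. MA (\<lambda>p. complex_of_real (u \<alpha> p)) q / complex_of_real (u \<alpha> q) ^ (2 * CARD('n) + 1)"
  have inv: "?R \<alpha> (\<phi> \<alpha> x) = ?R \<beta> (\<phi> \<beta> x)"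
    if ab: "\<alpha> \<in> I" "\<beta> \<in> I" and x: "x \<in> U \<alpha>" "x \<in> U \<beta>" for \<alpha> \<beta> x
  proof -
    let ?h = "matrix_inv (g \<alpha> \<beta>)" and ?N = "\<phi> \<alpha> ` (U \<alpha> \<inter> U \<beta>)" and ?T = "\<phi> \<beta> ` U \<beta>"
    note tr = transition_domains[OF atlas ab]
    have h: "det (cmat ?h) = 1"
      using atlas ab unfolding qp_flat_atlas_def SLH_def by (intro det_cmat_matrix_inv) auto
    have T: "open ?T"
      using atlas ab unfolding qp_flat_atlas_def by blast
    have C2: "Ck_on (Suc (Suc 0)) ?T (u \<beta>)"
      using section_u ab unfolding smooth_section_def smooth_on_def by blast
    have s: "\<forall>y\<in>?N. pdenom ?h y \<noteq> 0"
      using atlas ab unfolding qp_flat_atlas_def by blast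
    have u: "\<forall>y\<in>?N. u \<alpha> y = inverse ((norm (pdenom ?h y))\<^sup>2) * u \<beta> (pact ?h y)"
      using section_u ab unfolding smooth_section_def by blast
    have q: "\<phi> \<alpha> x \<in> ?N" "pact ?h ` ?N \<subseteq> ?T"
      using x tr(3) by (auto simp flip: tr(3))
    let ?\<rho> = "complex_of_real (inverse ((norm (pdenom ?h (\<phi> \<alpha> x)))\<^sup>2)) ^ (2 * CARD('n) + 1)"
    have MA: "MA (\<lambda>p. complex_of_real (u \<alpha> p)) (\<phi> \<alpha> x)
        = ?\<rho> * MA (\<lambda>p. complex_of_real (u \<beta> p)) (\<phi> \<beta> x)"
      unfolding tr(3)[OF x] by (rule MA_weighted_pullback[OF h C2 T tr(2) q s u])
    have "?R \<alpha> (\<phi> \<alpha> x) = ?\<rho> * MA (\<lambda>p. complex_of_real (u \<beta> p)) (\<phi> \<beta> x)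
        / (?\<rho> * complex_of_real (u \<beta> (\<phi> \<beta> x)) ^ (2 * CARD('n) + 1))"
      unfolding MA u[rule_format, OF q(1)] tr(3)[OF x]
      by (simp only: of_real_mult power_mult_distrib)
    also have "\<dots> = ?R \<beta> (\<phi> \<beta> x)"
      using s[rule_format, OF q(1)] by (intro mult_divide_mult_cancel_left) simp
    finally show ?thesis .
  qed
  have "?R \<alpha> q = ?R \<beta> (pact (matrix_inv (g \<alpha> \<beta>)) q)"
    if ab: "\<alpha> \<in> I" "\<beta> \<in> I" and q: "q \<in> \<phi> \<alpha> ` (U \<alpha> \<inter> U \<beta>)" for \<alpha> \<beta> q
    using inv[OF ab] transition_domains(3)[OF atlas ab] q by auto
  \<comment> \<open>any chart around \<open>x\<close> serves, as all of them give the same value\<close>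
  moreover define F where "F x = (let \<alpha> = SOME \<alpha>. \<alpha> \<in> I \<and> x \<in> U \<alpha> in ?R \<alpha> (\<phi> \<alpha> x))" for x
  have "F x = ?R \<alpha> (\<phi> \<alpha> x)" if "\<alpha> \<in> I" "x \<in> U \<alpha>" for \<alpha> x
  proof -
    have "(SOME \<alpha>. \<alpha> \<in> I \<and> x \<in> U \<alpha>) \<in> I \<and> x \<in> U (SOME \<alpha>. \<alpha> \<in> I \<and> x \<in> U \<alpha>)"
      using someI[of "\<lambda>\<alpha>. \<alpha> \<in> I \<and> x \<in> U \<alpha>"] that by blast
    then show ?thesis
      unfolding F_def Let_def using that by (intro inv) auto
  qed
  ultimately show ?thesis
    by blast
qed

end
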